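(* Let $1<p<\infty$. The James $p$-space $J_{p}$ has property $p$-$(V^{*})$.
   Context: For $1\le p<\infty$, a sequence $(z_n)_n$ in a Banach space $Z$ is weakly $p$-summable if $\sum_{n}|\langle z^{*},z_n\rangle|^{p}<\infty$ for every $z^{*}\in Z^{*}$. A bounded subset $K$ of a Banach space $X$ is a $p$-$(V^{*})$ set if $\lim_{n}\sup_{x\in K}|\langle x_n^{*},x\rangle|=0$ for every weakly $p$-summable sequence $(x_n^{*})_n$ in $X^{*}$. A Banach space $X$ has property $p$-$(V^{*})$ (Pe{\l}czy\'nski's property $(V^* )$ of order $p$) if every $p$-$(V^{*})$ subset of $X$ is relatively weakly compact. The James $p$-space $J_p$ ($1<p<\infty$) is the real Banach space of all real sequences $(a_n)_n$ with $\lim_n a_n=0$ and $$\|(a_{n})_{n}\|_{cpv}=\frac{1}{2^{1/p}}\sup\Big\{\Big(\sum_{j=1}^{m}|a_{i_{j-1}}-a_{i_{j}}|^{p}+|a_{i_{m}}-a_{i_{0}}|^{p}\Big)^{1/p}:1\leq i_{0}<i_{1}<\cdots<i_{m},\ m\in \mathbb{N}\Big\}<\infty,$$ with norm $\|\cdot\|_{cpv}$. An equivalent norm is $\|(a_n)_n\|_{pv}=\sup\{(\sum_{j=1}^{m}|a_{i_{j-1}}-a_{i_{j}}|^{p})^{1/p}:1\leq i_{0}<\cdots<i_{m},\ m\in\mathbb{N}\}$. *)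

theory Defs
  imports "HOL-Analysis.Analysis" "HOL-Library.Function_Algebras"
begin

text \<open>
  The James spaces form a family indexed by a real number, so they cannot be given as instances
  of the type class of Banach spaces.  A normed space is therefore represented by a linear subspace
  of an ambient real vector space together with a norm on it; values of the norm outside the
  subspace are irrelevant.  Sequence spaces and duals live in function types, on which the vector
  operations are pointwise.
\<close>

instantiation "fun" :: (type, real_vector) real_vector
begin

definition scaleR_fun :: "real \<Rightarrow> ('a \<Rightarrow> 'b) \<Rightarrow> 'a \<Rightarrow> 'b" where
  "scaleR_fun c f = (\<lambda>x. c *\<^sub>R f x)"

instance
  by standard (simp_all add: scaleR_fun_def fun_eq_iff scaleR_add_right scaleR_add_left)

end

record 'a normed_space =
  vectors :: "'a set"
  nrm :: "'a \<Rightarrow> real"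

definition is_normed_space :: "'a::real_vector normed_space \<Rightarrow> bool" where
  "is_normed_space X \<longleftrightarrow>
     subspace (vectors X) \<and>
     (\<forall>x\<in>vectors X. nrm X x = 0 \<longleftrightarrow> x = 0) \<and>
     (\<forall>c. \<forall>x\<in>vectors X. nrm X (c *\<^sub>R x) = \<bar>c\<bar> * nrm X x) \<and>
     (\<forall>x\<in>vectors X. \<forall>y\<in>vectors X. nrm X (x + y) \<le> nrm X x + nrm X y)"

definition is_banach_space :: "'a::real_vector normed_space \<Rightarrow> bool" where
  "is_banach_space X \<longleftrightarrow>
     is_normed_space X \<and>
     (\<forall>s. (\<forall>n::nat. s n \<in> vectors X) \<and>
          (\<forall>e>0. \<exists>N. \<forall>m\<ge>N. \<forall>n\<ge>N. nrm X (s m - s n) < e) \<longrightarrow>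
          (\<exists>x\<in>vectors X. (\<lambda>n. nrm X (s n - x)) \<longlonglongrightarrow> 0))"

text \<open>
  A functional on a normed space is a function on the ambient type.  Requiring it to vanish
  outside the subspace makes it determined by its restriction, so that distinct elements of
  the dual are distinct as functionals.
\<close>

definition dual :: "'a::real_vector normed_space \<Rightarrow> ('a \<Rightarrow> real) normed_space" where
  "dual X =
     \<lparr> vectors = {f. (\<forall>x\<in>vectors X. \<forall>y\<in>vectors X. f (x + y) = f x + f y) \<and>
                     (\<forall>c. \<forall>x\<in>vectors X. f (c *\<^sub>R x) = c * f x) \<and>
                     (\<exists>B. \<forall>x\<in>vectors X. \<bar>f x\<bar> \<le> B * nrm X x) \<and>
                     (\<forall>x. x \<notin> vectors X \<longrightarrow> f x = 0)},
       nrm = (\<lambda>f. SUP x\<in>{x \<in> vectors X. nrm X x \<le> 1}. \<bar>f x\<bar>) \<rparr>"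

definition weak_topology :: "'a::real_vector normed_space \<Rightarrow> 'a topology" where
  "weak_topology X =
     topology_generated_by {{x \<in> vectors X. f x \<in> U} | f U. f \<in> vectors (dual X) \<and> open U}"

definition relatively_weakly_compact :: "'a::real_vector normed_space \<Rightarrow> 'a set \<Rightarrow> bool" where
  "relatively_weakly_compact X K \<longleftrightarrow>
     K \<subseteq> vectors X \<and> compactin (weak_topology X) (weak_topology X closure_of K)"

definition weakly_p_summable ::
    "real \<Rightarrow> 'a::real_vector normed_space \<Rightarrow> (nat \<Rightarrow> 'a) \<Rightarrow> bool" where
  "weakly_p_summable p Z z \<longleftrightarrow>
     (\<forall>n. z n \<in> vectors Z) \<and>
     (\<forall>f\<in>vectors (dual Z). summable (\<lambda>n. \<bar>f (z n)\<bar> powr p))"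

text \<open>
  The supremum is taken in the extended nonnegative reals, where it is \<open>0\<close> for \<open>K = {}\<close>;
  for nonempty bounded \<open>K\<close> it is finite and agrees with the real supremum.
\<close>

definition p_Vstar_set :: "real \<Rightarrow> 'a::real_vector normed_space \<Rightarrow> 'a set \<Rightarrow> bool" where
  "p_Vstar_set p X K \<longleftrightarrow>
     K \<subseteq> vectors X \<and>
     (\<exists>B. \<forall>x\<in>K. nrm X x \<le> B) \<and>
     (\<forall>f. weakly_p_summable p (dual X) f \<longrightarrow>
          (\<lambda>n. SUP x\<in>K. ennreal \<bar>f n x\<bar>) \<longlonglongrightarrow> 0)"

definition has_property_p_Vstar :: "real \<Rightarrow> 'a::real_vector normed_space \<Rightarrow> bool" where
  "has_property_p_Vstar p X \<longleftrightarrow>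
     is_banach_space X \<and>
     (\<forall>K. p_Vstar_set p X K \<longrightarrow> relatively_weakly_compact X K)"

text \<open>
  Sequences are indexed from \<open>0\<close> instead of \<open>1\<close>.  Only \<open>i 0 < \<dots> < i m\<close> matters in
  \<^term>\<open>cyclic_variations p a\<close>; later values of \<open>i\<close> are unconstrained.
\<close>

definition cyclic_variations :: "real \<Rightarrow> (nat \<Rightarrow> real) \<Rightarrow> real set" where
  "cyclic_variations p a =
     {((\<Sum>j=1..m. \<bar>a (i (j - 1)) - a (i j)\<bar> powr p) + \<bar>a (i m) - a (i 0)\<bar> powr p) powr (1 / p)
       | (i :: nat \<Rightarrow> nat) m. 1 \<le> m \<and> strict_mono_on {0..m} i}"

definition james_space :: "real \<Rightarrow> (nat \<Rightarrow> real) normed_space" where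
  "james_space p =
     \<lparr> vectors = {a. a \<longlonglongrightarrow> 0 \<and> bdd_above (cyclic_variations p a)},
       nrm = (\<lambda>a. 1 / 2 powr (1 / p) * Sup (cyclic_variations p a)) \<rparr>"

end

theory Submission
  imports Defs
begin

text \<open>
  Write \<open>J\<close> for the James space and let \<open>K\<close> be a \<open>p\<close>-\<open>(V\<^sup>*)\<close> subset of \<open>J\<close>.  The
  candidate for a weakly compact set containing \<open>K\<close> is its closure \<open>C\<close> in the topology of
  pointwise convergence.  Two facts make this work.

  The first is that \<open>C\<close> is contained in \<open>J\<close> (\<open>p_Vstar_closure_bounded\<close>).  Variation sums depend on
  finitely many coordinates, so the bound on \<open>K\<close> passes to \<open>C\<close>; what could fail is convergence to
  \<open>0\<close>.  If some \<open>x \<in> C\<close> does not tend to \<open>0\<close>, then members \<open>y\<^sub>j\<close> of \<open>K\<close>, which do tend to \<open>0\<close>,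
  satisfy \<open>\<bar>y\<^sub>j (n\<^sub>j) - y\<^sub>j (m\<^sub>j)\<bar> \<ge> \<delta>\<close> for indices \<open>n\<^sub>0 < m\<^sub>0 < n\<^sub>1 < m\<^sub>1 < \<dots>\<close>.  The functionals
  \<open>f\<^sub>j x = x (n\<^sub>j) - x (m\<^sub>j)\<close> form a weakly \<open>p\<close>-summable sequence in the dual, because
  \<open>\<Sum>\<^sub>j \<bar>f\<^sub>j x\<bar>\<^sup>p\<close> is part of a variation sum of \<open>x\<close> and hence bounded on the unit ball of \<open>J\<close>
  (\<open>weakly_p_summable_dualI\<close> turns such a bound, tested on \<open>J\<close> only, into weak summability, which is
  tested on the bidual).  They are not uniformly small on \<open>K\<close>, contradicting the choice of \<open>K\<close>.

  The second is that every functional \<open>f\<close> on \<open>J\<close> is continuous for pointwise convergence on norm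
  bounded sets (\<open>james_dual_pointwise_continuous\<close>); in other words, the unit vector basis of \<open>J\<close>
  is shrinking.  If \<open>f\<close> were not small on vectors supported far out, there would be
  successive finitely supported blocks of bounded norm with \<open>f\<close> at least \<open>e\<close> on each of
  them.  Blocks satisfy an upper \<open>p\<close>-estimate: \<open>N\<close> of them add up to a vector of norm
  \<open>O(N\<^bsup>1/p\<^esup>)\<close>, whereas \<open>f\<close> is at least \<open>N e\<close> there.  As \<open>p > 1\<close>, this is impossible for large \<open>N\<close>.

  By Tychonoff's theorem \<open>C\<close> is compact for pointwise convergence, hence weakly compact by the second
  fact, and the weak closure of \<open>K\<close> is a weakly closed subset of \<open>C\<close>.

  The upper \<open>p\<close>-estimate comes from replacing the norm by a quantity that is subadditive on the nose.
  For a chain \<open>xs\<close> of indices, \<open>weighted_sum p a xs\<close> is the variation sum of \<open>a\<close> along \<open>xs\<close> plus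
  \<open>2\<^sup>p \<bar>a k\<bar>\<^sup>p\<close> for the first and the last index \<open>k\<close> of \<open>xs\<close>.  When a chain is cut in two, the
  end terms at the cut pay for the lost link, so that
  \<open>weighted_sum p a (ys @ zs) \<le> weighted_sum p a ys + weighted_sum p a zs\<close>.  The \<open>p\<close>-th power of the
  norm of \<open>J\<close> is equivalent to the supremum of the weighted sums.
\<close>

section \<open>Minkowski's inequality for finite sums\<close>

text \<open>
  Convexity of the power function including the endpoint \<open>0\<close>, where it follows from
  \<open>s\<^sup>p \<le> s\<close> on the unit interval.
\<close>
lemma powr_convex_combination_le:
  fixes x y t p :: real
  assumes p: "1 \<le> p" and x: "0 \<le> x" and y: "0 \<le> y" and t: "0 \<le> t" "t \<le> 1"
  shows "(t * x + (1 - t) * y) powr p \<le> t * x powr p + (1 - t) * y powr p"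
proof -
  have shrink: "(s * z) powr p \<le> s * z powr p" if "0 \<le> s" "s \<le> 1" for s z :: real
  proof (cases "s = 0")
    case False
    then have "s powr p \<le> s" using powr_mono'[OF p, of s] that by simp
    then show ?thesis using that by (simp add: powr_mult mult_right_mono)
  qed simp
  show ?thesis
  proof (cases "x = 0 \<or> y = 0")
    case True
    then show ?thesis using shrink[of "1 - t" y] shrink[of t x] t by auto
  next
    case False
    then show ?thesis using convex_onD[OF powr_convex[OF p], of "1 - t" x y] x y t by simp
  qed
qed

text \<open>
  Convexity of the \<open>p\<close>-th power gives the triangle inequality by homogeneity: if \<open>\<alpha>\<close> and \<open>\<beta>\<close> exceed
  the two \<open>p\<close>-norms, then \<open>(x + y) / (\<alpha> + \<beta>)\<close> is a convex combination of \<open>x / \<alpha>\<close> and \<open>y / \<beta>\<close>, whose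
  \<open>p\<close>-norms are at most \<open>1\<close>.  Taking strict upper bounds avoids a case distinction for vanishing norms.
\<close>
lemma Minkowski_inequality_sum:
  fixes x y :: "'a \<Rightarrow> real"
  assumes p: "1 \<le> p"
  shows "(\<Sum>k\<in>A. \<bar>x k + y k\<bar> powr p) powr (1/p)
         \<le> (\<Sum>k\<in>A. \<bar>x k\<bar> powr p) powr (1/p) + (\<Sum>k\<in>A. \<bar>y k\<bar> powr p) powr (1/p)"
proof -
  define N where "N z = (\<Sum>k\<in>A. \<bar>z k\<bar> powr p) powr (1/p)" for z :: "'a \<Rightarrow> real"
  have N0: "0 \<le> N z" for z by (simp add: N_def)
  have NP: "N z powr p = (\<Sum>k\<in>A. \<bar>z k\<bar> powr p)" for z
    using p by (simp add: N_def powr_powr sum_nonneg)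
  have main: "N (\<lambda>k. x k + y k) \<le> \<alpha> + \<beta>" if ab: "N x < \<alpha>" "N y < \<beta>" for \<alpha> \<beta>
  proof -
    have pos: "0 < \<alpha>" "0 < \<beta>" using ab N0[of x] N0[of y] by linarith+
    define t where "t = \<alpha> / (\<alpha> + \<beta>)"
    have t: "0 \<le> t" "t \<le> 1" "1 - t = \<beta> / (\<alpha> + \<beta>)"
      using pos by (auto simp: t_def field_simps)
    have pt: "\<bar>u + v\<bar> powr p \<le> (\<alpha>+\<beta>) powr p * (t * (\<bar>u\<bar> powr p / \<alpha> powr p) + (1-t) * (\<bar>v\<bar> powr p / \<beta> powr p))"
      for u v :: real
    proof -
      have eq: "\<bar>u\<bar> + \<bar>v\<bar> = (\<alpha>+\<beta>) * (t * (\<bar>u\<bar>/\<alpha>) + (1-t) * (\<bar>v\<bar>/\<beta>))"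
      proof -
        have "(\<alpha>+\<beta>) * (t * (\<bar>u\<bar>/\<alpha>)) = \<bar>u\<bar>" "(\<alpha>+\<beta>) * ((1-t) * (\<bar>v\<bar>/\<beta>)) = \<bar>v\<bar>"
          using pos unfolding t(3) by (simp_all add: t_def)
        then show ?thesis by (simp only: distrib_left)
      qed
      have "\<bar>u + v\<bar> powr p \<le> (\<bar>u\<bar> + \<bar>v\<bar>) powr p"
        using p by (intro powr_mono2) auto
      also have "\<dots> = (\<alpha>+\<beta>) powr p * (t * (\<bar>u\<bar>/\<alpha>) + (1-t) * (\<bar>v\<bar>/\<beta>)) powr p"
        unfolding eq using pos t by (intro powr_mult)
      also have "\<dots> \<le> (\<alpha>+\<beta>) powr p * (t * (\<bar>u\<bar>/\<alpha>) powr p + (1-t) * (\<bar>v\<bar>/\<beta>) powr p)"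
        using pos t p by (intro mult_left_mono powr_convex_combination_le) auto
      also have "\<dots> = (\<alpha>+\<beta>) powr p * (t * (\<bar>u\<bar> powr p / \<alpha> powr p) + (1-t) * (\<bar>v\<bar> powr p / \<beta> powr p))"
        using pos by (simp add: powr_divide)
      finally show ?thesis .
    qed
    have le1: "(\<Sum>k\<in>A. \<bar>x k\<bar> powr p) / \<alpha> powr p \<le> 1" "(\<Sum>k\<in>A. \<bar>y k\<bar> powr p) / \<beta> powr p \<le> 1"
      using ab N0 p pos unfolding NP[symmetric] by (auto intro!: powr_mono2)
    have "N (\<lambda>k. x k + y k) powr p \<le>
      (\<Sum>k\<in>A. (\<alpha>+\<beta>) powr p * (t * (\<bar>x k\<bar> powr p / \<alpha> powr p) + (1-t) * (\<bar>y k\<bar> powr p / \<beta> powr p)))"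
      unfolding NP by (intro sum_mono pt)
    also have "\<dots> = (\<alpha>+\<beta>) powr p * (t * ((\<Sum>k\<in>A. \<bar>x k\<bar> powr p) / \<alpha> powr p)
                      + (1-t) * ((\<Sum>k\<in>A. \<bar>y k\<bar> powr p) / \<beta> powr p))"
      by (simp only: sum_distrib_left sum_divide_distrib sum.distrib[symmetric])
    also have "\<dots> \<le> (\<alpha>+\<beta>) powr p * (t * 1 + (1-t) * 1)"
      using le1 t by (intro mult_left_mono add_mono) auto
    finally have le: "N (\<lambda>k. x k + y k) powr p \<le> (\<alpha>+\<beta>) powr p" by simp
    show ?thesis
    proof (rule ccontr)
      assume "\<not> ?thesis"
      then have "(\<alpha>+\<beta>) powr p < N (\<lambda>k. x k + y k) powr p"
        using pos p by (intro powr_less_mono2) auto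
      with le show False by simp
    qed
  qed
  have "N (\<lambda>k. x k + y k) \<le> N x + N y"
  proof (rule field_le_epsilon)
    fix e :: real assume "0 < e"
    then show "N (\<lambda>k. x k + y k) \<le> N x + N y + e"
      using main[of "N x + e/2" "N y + e/2"] by simp
  qed
  then show ?thesis by (simp add: N_def)
qed

section \<open>Functionals and weakly summable sequences in a dual space\<close>

lemma dualI:
  assumes "\<And>x y. x \<in> vectors X \<Longrightarrow> y \<in> vectors X \<Longrightarrow> f (x + y) = f x + f y"
    and "\<And>c x. x \<in> vectors X \<Longrightarrow> f (c *\<^sub>R x) = c * f x"
    and "\<And>x. x \<in> vectors X \<Longrightarrow> \<bar>f x\<bar> \<le> B * nrm X x"
    and "\<And>x. x \<notin> vectors X \<Longrightarrow> f x = 0"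
  shows "f \<in> vectors (dual X)"
  using assms unfolding dual_def by (auto intro!: exI[of _ B])

lemma dualD:
  assumes "f \<in> vectors (dual X)"
  shows "x \<in> vectors X \<Longrightarrow> y \<in> vectors X \<Longrightarrow> f (x + y) = f x + f y"
    "x \<in> vectors X \<Longrightarrow> f (c *\<^sub>R x) = c * f x"
    "x \<notin> vectors X \<Longrightarrow> f x = 0"
    "\<exists>B. \<forall>x\<in>vectors X. \<bar>f x\<bar> \<le> B * nrm X x"
  using assms unfolding dual_def by simp_all

lemma dual_add:
  assumes f: "f \<in> vectors (dual X)" and g: "g \<in> vectors (dual X)"
  shows "f + g \<in> vectors (dual X)"
proof -
  obtain B C where B: "\<forall>x\<in>vectors X. \<bar>f x\<bar> \<le> B * nrm X x"
    and C: "\<forall>x\<in>vectors X. \<bar>g x\<bar> \<le> C * nrm X x"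
    using dualD(4)[OF f] dualD(4)[OF g] by blast
  have "\<bar>(f + g) x\<bar> \<le> (B + C) * nrm X x" if "x \<in> vectors X" for x
    using B C that by (fastforce simp: distrib_right)
  then show ?thesis
    by (intro dualI[of X "f + g" "B + C"]) (auto simp: dualD(1-3)[OF f] dualD(1-3)[OF g] algebra_simps)
qed

lemma dual_scale:
  assumes f: "f \<in> vectors (dual X)"
  shows "c *\<^sub>R f \<in> vectors (dual X)"
proof -
  obtain B where B: "\<forall>x\<in>vectors X. \<bar>f x\<bar> \<le> B * nrm X x"
    using dualD(4)[OF f] by blast
  have "\<bar>(c *\<^sub>R f) x\<bar> \<le> (\<bar>c\<bar> * B) * nrm X x" if "x \<in> vectors X" for x
    using mult_left_mono[OF bspec[OF B that], of "\<bar>c\<bar>"]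
    by (simp add: scaleR_fun_def abs_mult mult.assoc)
  then show ?thesis
    by (intro dualI[of X "c *\<^sub>R f" "\<bar>c\<bar> * B"])
      (auto simp: dualD(1-3)[OF f] scaleR_fun_def algebra_simps)
qed

lemma dual_zero: "0 \<in> vectors (dual X)"
  by (rule dualI[where B = 0]) auto

lemma normed_space_norm_nonneg:
  assumes X: "is_normed_space X" and x: "x \<in> vectors X"
  shows "0 \<le> nrm X x"
proof -
  have sub: "subspace (vectors X)" using X by (simp add: is_normed_space_def)
  have "nrm X 0 = 0" using X subspace_0[OF sub] by (simp add: is_normed_space_def)
  moreover have "nrm X (x + (-1) *\<^sub>R x) \<le> nrm X x + nrm X ((-1) *\<^sub>R x)"
    using X x subspace_scale[OF sub x, of "-1"] unfolding is_normed_space_def by blast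
  moreover have "nrm X ((-1) *\<^sub>R x) = \<bar>-1\<bar> * nrm X x"
    using X x unfolding is_normed_space_def by blast
  ultimately show ?thesis by simp
qed

lemma dual_norm_nonneg:
  assumes X: "is_normed_space X" and g: "g \<in> vectors (dual X)"
  shows "0 \<le> nrm (dual X) g"
proof -
  obtain B where B: "\<forall>x\<in>vectors X. \<bar>g x\<bar> \<le> B * nrm X x" using dualD(4)[OF g] by blast
  have "\<bar>g x\<bar> \<le> \<bar>B\<bar>" if x: "x \<in> vectors X" "nrm X x \<le> 1" for x
  proof -
    have "B * nrm X x \<le> \<bar>B\<bar> * 1"
      using normed_space_norm_nonneg[OF X x(1)] x(2) by (intro mult_mono) auto
    then show ?thesis using B x(1) by fastforce
  qed
  then have bdd: "bdd_above ((\<lambda>x. \<bar>g x\<bar>) ` {x \<in> vectors X. nrm X x \<le> 1})"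
    by (intro bdd_aboveI2[where M = "\<bar>B\<bar>"]) auto
  have "0 \<in> {x \<in> vectors X. nrm X x \<le> 1}"
    using X by (auto simp: is_normed_space_def subspace_def)
  then have "\<bar>g 0\<bar> \<le> (SUP x\<in>{x \<in> vectors X. nrm X x \<le> 1}. \<bar>g x\<bar>)"
    using bdd by (intro cSUP_upper)
  then show ?thesis by (simp add: dual_def order_trans[OF abs_ge_zero])
qed

lemma dual_norm_le:
  assumes X: "is_normed_space X"
    and le: "\<And>x. x \<in> vectors X \<Longrightarrow> nrm X x \<le> 1 \<Longrightarrow> \<bar>g x\<bar> \<le> b"
  shows "nrm (dual X) g \<le> b"
proof -
  have "0 \<in> {x \<in> vectors X. nrm X x \<le> 1}"
    using X by (auto simp: is_normed_space_def subspace_def)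
  then have "(SUP x\<in>{x \<in> vectors X. nrm X x \<le> 1}. \<bar>g x\<bar>) \<le> b"
    using le by (intro cSUP_least) auto
  then show ?thesis by (simp add: dual_def)
qed

text \<open>
  A weighted form of Young's inequality with non-optimal constants, obtained by distinguishing
  whether \<open>b\<close> or \<open>\<epsilon> t\<close> is larger.  It replaces Hoelder's inequality below.
\<close>
lemma powr_times_le:
  fixes t b \<epsilon> p :: real
  assumes p: "1 < p" and t: "0 \<le> t" and b: "0 \<le> b" and \<epsilon>: "0 < \<epsilon>"
  shows "t powr (p - 1) * b \<le> \<epsilon> * t powr p + \<epsilon> powr (1 - p) * b powr p"
proof -
  have pow: "s powr (p - 1) * s = s powr p" if "0 \<le> s" for s :: real
    using that powr_add[of s "p - 1" 1] by (cases "s = 0") auto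
  show ?thesis
  proof (cases "b \<le> \<epsilon> * t")
    case True
    then have "t powr (p - 1) * b \<le> t powr (p - 1) * (\<epsilon> * t)" by (intro mult_left_mono) auto
    also have "\<dots> = \<epsilon> * t powr p" using pow[OF t] by (simp add: mult_ac)
    finally show ?thesis by (simp add: add_increasing2)
  next
    case False
    then have "t \<le> b / \<epsilon>" using \<epsilon> by (simp add: field_simps)
    then have "t powr (p - 1) * b \<le> (b / \<epsilon>) powr (p - 1) * b"
      using t b p by (intro mult_right_mono powr_mono2) auto
    also have "\<dots> = \<epsilon> powr (1 - p) * b powr p"
      using pow[OF b] powr_minus_divide[of \<epsilon> "p - 1"] by (simp add: powr_divide mult_ac)
    finally show ?thesis using \<epsilon> by (simp add: add_increasing)
  qed
qed

text \<open>
  Weak summability in the dual is tested by functionals \<open>\<phi>\<close> on the dual, but it suffices to have the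
  bound on points of \<open>X\<close>.  Evaluate \<open>\<phi>\<close> at \<open>g = \<Sum>\<^sub>j c\<^sub>j f\<^sub>j\<close> (over \<open>j < N\<close>), where
  \<open>c\<^sub>j = sgn (\<phi> f\<^sub>j) \<bar>\<phi> f\<^sub>j\<bar>\<^bsup>p-1\<^esup>\<close>, so that \<open>\<phi> g\<close> is exactly the partial sum \<open>T\<close> to be bounded.  Young's
  inequality bounds the norm of \<open>g\<close> by \<open>\<epsilon> T\<close> plus a constant, and \<open>\<epsilon>\<close> can be chosen so small that the
  term with \<open>T\<close> is absorbed on the left.
\<close>
lemma weakly_p_summable_dualI:
  assumes p: "1 < p" and X: "is_normed_space X"
    and f: "\<And>j. f j \<in> vectors (dual X)"
    and A: "\<And>x N. x \<in> vectors X \<Longrightarrow> nrm X x \<le> 1 \<Longrightarrow> (\<Sum>j<N. \<bar>f j x\<bar> powr p) \<le> A"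
  shows "weakly_p_summable p (dual X) f"
  unfolding weakly_p_summable_def
proof (intro conjI allI ballI f)
  fix \<phi> assume \<phi>: "\<phi> \<in> vectors (dual (dual X))"
  note add = dualD(1)[OF \<phi>] and scale = dualD(2)[OF \<phi>]
  obtain B where B: "\<forall>g\<in>vectors (dual X). \<bar>\<phi> g\<bar> \<le> B * nrm (dual X) g"
    using dualD(4)[OF \<phi>] by blast
  (* a bound of \<phi> that is positive, so that one can divide by it *)
  define M where "M = max B 1"
  define t where "t j = \<bar>\<phi> (f j)\<bar>" for j
  define c where "c j = sgn (\<phi> (f j)) * t j powr (p - 1)" for j
  (* with this choice the term M \<epsilon> T below is half of T *)
  define \<epsilon> where "\<epsilon> = 1 / (2 * M)"
  have M: "1 \<le> M" "B \<le> M" and \<epsilon>: "0 < \<epsilon>" by (auto simp: M_def \<epsilon>_def)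
  have c\<phi>: "c j * \<phi> (f j) = t j powr p" for j
    using powr_add[of "t j" "p - 1" 1] by (auto simp: c_def t_def sgn_if)
  have comb: "(\<lambda>x. \<Sum>j<N. c j * f j x) \<in> vectors (dual X) \<and>
      \<phi> (\<lambda>x. \<Sum>j<N. c j * f j x) = (\<Sum>j<N. t j powr p)" for N
  proof (induction N)
    case 0
    have "\<phi> 0 = 0" using scale[OF dual_zero, of 0] by simp
    then show ?case using dual_zero[of X] by (simp add: zero_fun_def)
  next
    case (Suc N)
    have eq: "(\<lambda>x. \<Sum>j<Suc N. c j * f j x) = (\<lambda>x. \<Sum>j<N. c j * f j x) + c N *\<^sub>R f N"
      by (simp add: fun_eq_iff scaleR_fun_def)
    show ?case
      unfolding eq using Suc dual_add[OF _ dual_scale[OF f]] add[OF _ dual_scale[OF f]] scale[OF f] c\<phi>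
      by simp
  qed
  have A0: "0 \<le> A"
    using A[of 0 0] X by (auto simp: is_normed_space_def subspace_def)
  show "summable (\<lambda>n. \<bar>\<phi> (f n)\<bar> powr p)"
  proof (rule summableI_nonneg_bounded)
    fix N
    define g where "g = (\<lambda>x. \<Sum>j<N. c j * f j x)"
    define T where "T = (\<Sum>j<N. t j powr p)"
    have g: "g \<in> vectors (dual X)" "\<phi> g = T" using comb[of N] by (auto simp: g_def T_def)
    have T0: "0 \<le> T" by (simp add: T_def sum_nonneg)
    have "nrm (dual X) g \<le> \<epsilon> * T + \<epsilon> powr (1 - p) * A"
    proof (rule dual_norm_le[OF X])
      fix x assume x: "x \<in> vectors X" "nrm X x \<le> 1"
      have "\<bar>g x\<bar> \<le> (\<Sum>j<N. \<bar>c j * f j x\<bar>)" unfolding g_def by (rule sum_abs)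
      also have "\<dots> \<le> (\<Sum>j<N. \<epsilon> * t j powr p + \<epsilon> powr (1 - p) * \<bar>f j x\<bar> powr p)"
      proof (rule sum_mono)
        fix j
        have "\<bar>c j * f j x\<bar> \<le> t j powr (p - 1) * \<bar>f j x\<bar>"
          by (auto simp: c_def abs_mult sgn_if)
        also have "\<dots> \<le> \<epsilon> * t j powr p + \<epsilon> powr (1 - p) * \<bar>f j x\<bar> powr p"
          using p \<epsilon> by (intro powr_times_le) (auto simp: t_def)
        finally show "\<bar>c j * f j x\<bar> \<le> \<epsilon> * t j powr p + \<epsilon> powr (1 - p) * \<bar>f j x\<bar> powr p" .
      qed
      also have "\<dots> = \<epsilon> * T + \<epsilon> powr (1 - p) * (\<Sum>j<N. \<bar>f j x\<bar> powr p)"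
        by (simp add: T_def sum.distrib sum_distrib_left)
      also have "\<dots> \<le> \<epsilon> * T + \<epsilon> powr (1 - p) * A"
        using A[OF x] by (intro add_left_mono mult_left_mono) auto
      finally show "\<bar>g x\<bar> \<le> \<epsilon> * T + \<epsilon> powr (1 - p) * A" .
    qed
    then have "B * nrm (dual X) g \<le> M * (\<epsilon> * T + \<epsilon> powr (1 - p) * A)"
      using M dual_norm_nonneg[OF X g(1)] by (intro mult_mono) auto
    then have "T \<le> M * (\<epsilon> * T + \<epsilon> powr (1 - p) * A)" using bspec[OF B g(1)] g(2) by linarith
    also have "\<dots> = T / 2 + M * \<epsilon> powr (1 - p) * A"
      using M by (simp add: \<epsilon>_def distrib_left)
    finally show "(\<Sum>n<N. \<bar>\<phi> (f n)\<bar> powr p) \<le> 2 * (M * \<epsilon> powr (1 - p) * A)"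
      by (simp add: T_def t_def)
  qed simp
qed

section \<open>Weak compactness in spaces of real functions\<close>

text \<open>
  Here and in \<open>relatively_weakly_compactI\<close> the set \<open>C\<close> carries the topology of its ambient type,
  which for sequences is that of pointwise convergence.
\<close>
lemma weak_topology_continuous_mapI:
  assumes "C \<subseteq> vectors X" "\<And>f. f \<in> vectors (dual X) \<Longrightarrow> continuous_on C f"
  shows "continuous_map (top_of_set C) (weak_topology X) (\<lambda>x. x)"
  unfolding weak_topology_def
proof (rule continuous_on_generated_topo)
  fix V assume "V \<in> {{x \<in> vectors X. f x \<in> U} | f U. f \<in> vectors (dual X) \<and> open U}"
  then obtain f U where f: "f \<in> vectors (dual X)" and U: "open U"
    and V: "V = {x \<in> vectors X. f x \<in> U}" by blast
  have "openin (top_of_set C) (C \<inter> f -` U)"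
    using assms(2)[OF f] U by (rule continuous_openin_preimage_gen)
  moreover have "(\<lambda>x. x) -` V \<inter> topspace (top_of_set C) = C \<inter> f -` U"
    using assms(1) by (auto simp: V)
  ultimately show "openin (top_of_set C) ((\<lambda>x. x) -` V \<inter> topspace (top_of_set C))" by simp
next
  have "vectors X \<in> {{x \<in> vectors X. f x \<in> U} | f U. f \<in> vectors (dual X) \<and> open U}"
    using dual_zero[of X] by (auto intro!: exI[of _ 0] exI[of _ UNIV])
  then show "(\<lambda>x. x) ` topspace (top_of_set C)
      \<subseteq> \<Union>{{x \<in> vectors X. f x \<in> U} | f U. f \<in> vectors (dual X) \<and> open U}"
    using assms(1) by (auto intro: Union_upper)
qed

lemma topspace_weak_topology: "topspace (weak_topology X) = vectors X"
proof -
  have "vectors X \<in> {{x \<in> vectors X. f x \<in> U} | f U. f \<in> vectors (dual X) \<and> open U}"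
    using dual_zero[of X] by (auto intro!: exI[of _ 0] exI[of _ UNIV])
  then show ?thesis unfolding weak_topology_def topology_generated_by_topspace by blast
qed

lemma weak_topology_continuous_functional:
  assumes "f \<in> vectors (dual X)"
  shows "continuous_map (weak_topology X) euclidean f"
  unfolding continuous_map_def topspace_weak_topology
  using assms unfolding weak_topology_def
  by (auto intro!: topology_generated_by_Basis)

text \<open>
  The assumption on functionals makes the compact set \<open>C\<close> weakly compact; weak continuity of the
  coordinates makes it weakly closed, so that it contains the weak closure of \<open>K\<close>.
\<close>
lemma relatively_weakly_compactI:
  fixes K :: "('a \<Rightarrow> real) set"
  assumes C: "compact C" "closed C" "K \<subseteq> C" "C \<subseteq> vectors X"
    and cont: "\<And>f. f \<in> vectors (dual X) \<Longrightarrow> continuous_on C f"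
    and coord: "\<And>k. continuous_map (weak_topology X) euclidean (\<lambda>x. x k)"
  shows "relatively_weakly_compact X K"
proof -
  have "compactin (top_of_set C) C" using C(1) by simp
  then have "compactin (weak_topology X) ((\<lambda>x. x) ` C)"
    by (rule image_compactin[OF _ weak_topology_continuous_mapI[OF C(4) cont]])
  then have cpt: "compactin (weak_topology X) C" by simp
  have "continuous_map (weak_topology X) euclidean (\<lambda>x. x)"
    unfolding euclidean_product_topology[symmetric] continuous_map_componentwise_UNIV
    using coord by simp
  from closedin_continuous_map_preimage[OF this, of C]
  have "closedin (weak_topology X) {x \<in> topspace (weak_topology X). x \<in> C}"
    using C(2) by simp
  moreover have "{x \<in> topspace (weak_topology X). x \<in> C} = C"
    using C(4) by (auto simp: topspace_weak_topology)
  ultimately have "weak_topology X closure_of K \<subseteq> C"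
    using closure_of_minimal[OF C(3)] by metis
  then have "compactin (weak_topology X) (weak_topology X closure_of K)"
    by (rule closed_compactin[OF cpt _ closedin_closure_of])
  then show ?thesis using C(3,4) by (simp add: relatively_weakly_compact_def)
qed

text \<open>
  An instance of Tychonoff's theorem.
\<close>
lemma compact_coordinate_box: "compact {x :: 'a \<Rightarrow> real. \<forall>k. \<bar>x k\<bar> \<le> R}"
proof -
  have "compactin (product_topology (\<lambda>_. euclidean) UNIV) (PiE UNIV (\<lambda>_::'a. {-R..R}))"
    unfolding compactin_PiE by simp
  moreover have "PiE UNIV (\<lambda>_::'a. {-R..R}) = {x. \<forall>k. \<bar>x k\<bar> \<le> R}"
    by (auto simp: PiE_def Pi_def abs_le_iff) (smt (verit))+
  ultimately show ?thesis by (simp add: euclidean_product_topology)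
qed

lemma pointwise_closure_approx:
  fixes x :: "'a \<Rightarrow> real"
  assumes "x \<in> closure K" "0 < e"
  obtains y where "y \<in> K" "\<bar>y n - x n\<bar> < e"
proof -
  have "open ((\<lambda>y. y n) -` ball (x n) e :: ('a \<Rightarrow> real) set)"
    by (intro open_vimage continuous_on_product_coordinates open_ball)
  moreover have "x \<in> (\<lambda>y. y n) -` ball (x n) e" using assms by simp
  ultimately have "(\<lambda>y. y n) -` ball (x n) e \<inter> K \<noteq> {}"
    using assms(1) open_Int_closure_eq_empty by blast
  then show thesis using that by (auto simp: dist_real_def abs_minus_commute)
qed

section \<open>Variation sums along finite chains of indices\<close>

text \<open>
  The \<open>p\<close>-th power of a member of \<^term>\<open>cyclic_variations p a\<close>.  Working with powers keeps the
  sums additive.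
\<close>
definition cyclic_sum :: "real \<Rightarrow> (nat \<Rightarrow> real) \<Rightarrow> (nat \<Rightarrow> nat) \<Rightarrow> nat \<Rightarrow> real" where
  "cyclic_sum p a i m =
     (\<Sum>j=1..m. \<bar>a (i (j - 1)) - a (i j)\<bar> powr p) + \<bar>a (i m) - a (i 0)\<bar> powr p"

lemma cyclic_sum_nonneg: "0 \<le> cyclic_sum p a i m"
  by (simp add: cyclic_sum_def sum_nonneg)

lemma cyclic_variations_eq:
  "cyclic_variations p a =
     {cyclic_sum p a i m powr (1/p) | i m. 1 \<le> m \<and> strict_mono_on {0..m} i}"
  by (simp add: cyclic_variations_def cyclic_sum_def)

text \<open>
  The closing term is the link from the last index to index \<open>0\<close>; with it, the cyclic sum is the \<open>p\<close>-th
  power of the \<open>p\<close>-norm of a vector of differences, to which Minkowski's inequality applies.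
\<close>
lemma cyclic_sum_alt:
  "cyclic_sum p a i m = (\<Sum>j\<in>{0..m}. \<bar>a (i (if j = 0 then m else j - 1)) - a (i j)\<bar> powr p)"
proof -
  have "(\<Sum>j\<in>{0..m}. \<bar>a (i (if j = 0 then m else j - 1)) - a (i j)\<bar> powr p) =
    \<bar>a (i m) - a (i 0)\<bar> powr p + (\<Sum>j\<in>{1..m}. \<bar>a (i (if j = 0 then m else j - 1)) - a (i j)\<bar> powr p)"
    by (simp add: sum.atLeast_Suc_atMost)
  also have "(\<Sum>j\<in>{1..m}. \<bar>a (i (if j = 0 then m else j - 1)) - a (i j)\<bar> powr p)
    = (\<Sum>j=1..m. \<bar>a (i (j - 1)) - a (i j)\<bar> powr p)"
    by (intro sum.cong) auto
  finally show ?thesis by (simp add: cyclic_sum_def)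
qed

lemma cyclic_sum_triangle:
  assumes "1 \<le> p"
  shows "cyclic_sum p (a + b) i m powr (1/p)
         \<le> cyclic_sum p a i m powr (1/p) + cyclic_sum p b i m powr (1/p)"
  using Minkowski_inequality_sum[OF assms, where A = "{0..m}"
      and x = "\<lambda>j. a (i (if j = 0 then m else j - 1)) - a (i j)"
      and y = "\<lambda>j. b (i (if j = 0 then m else j - 1)) - b (i j)"]
  unfolding cyclic_sum_alt by (simp add: algebra_simps)

lemma cyclic_sum_scale:
  "cyclic_sum p (c *\<^sub>R a) i m = \<bar>c\<bar> powr p * cyclic_sum p a i m"
  by (simp add: cyclic_sum_alt scaleR_fun_def sum_distrib_left abs_mult powr_mult
      flip: right_diff_distrib)

lemma cyclic_variations_nonempty: "cyclic_variations p a \<noteq> {}"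
proof -
  have "strict_mono_on {0..1} (\<lambda>k::nat. k)" by (simp add: monotone_on_def)
  then show ?thesis unfolding cyclic_variations_eq by blast
qed

text \<open>
  Chains are lists of indices here, because they have to be concatenated and cut.
\<close>
fun link_sum :: "real \<Rightarrow> (nat \<Rightarrow> real) \<Rightarrow> nat list \<Rightarrow> real" where
  "link_sum p a (x # y # zs) = \<bar>a x - a y\<bar> powr p + link_sum p a (y # zs)"
| "link_sum p a [x] = 0"
| "link_sum p a [] = 0"

text \<open>
  The factor \<open>2\<^sup>p\<close> of the end terms is the one that bounds a single link by its end points
  (\<open>abs_diff_powr_le\<close>).  The empty chain has no end points and gets the value \<open>0\<close>.
\<close>
definition weighted_sum :: "real \<Rightarrow> (nat \<Rightarrow> real) \<Rightarrow> nat list \<Rightarrow> real" where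
  "weighted_sum p a xs =
     (if xs = [] then 0
      else 2 powr p * \<bar>a (hd xs)\<bar> powr p + link_sum p a xs + 2 powr p * \<bar>a (last xs)\<bar> powr p)"

lemma abs_diff_powr_le:
  fixes s t :: real
  assumes "0 \<le> p"
  shows "\<bar>s - t\<bar> powr p \<le> 2 powr p * \<bar>s\<bar> powr p + 2 powr p * \<bar>t\<bar> powr p"
proof -
  have "\<bar>s - t\<bar> powr p \<le> (2 * max \<bar>s\<bar> \<bar>t\<bar>) powr p"
    using assms by (intro powr_mono2) auto
  also have "\<dots> = 2 powr p * max \<bar>s\<bar> \<bar>t\<bar> powr p" by (simp add: powr_mult)
  also have "\<dots> \<le> 2 powr p * (\<bar>s\<bar> powr p + \<bar>t\<bar> powr p)"
    by (intro mult_left_mono) (auto simp: max_def)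
  finally show ?thesis by (simp add: distrib_left)
qed

lemma link_sum_append:
  "xs \<noteq> [] \<Longrightarrow> ys \<noteq> [] \<Longrightarrow>
   link_sum p a (xs @ ys) = link_sum p a xs + \<bar>a (last xs) - a (hd ys)\<bar> powr p + link_sum p a ys"
proof (induction p a xs rule: link_sum.induct)
  case (2 p a x)
  then show ?case by (cases ys) auto
qed auto

lemma link_sum_append_ge: "link_sum p a xs + link_sum p a ys \<le> link_sum p a (xs @ ys)"
  by (cases "xs = []"; cases "ys = []") (auto simp: link_sum_append)

lemma link_sum_cong:
  "(\<And>x. x \<in> set xs \<Longrightarrow> a x = b x) \<Longrightarrow> link_sum p a xs = link_sum p b xs"
  by (induction p a xs rule: link_sum.induct) auto

lemma weighted_sum_cong:
  "(\<And>x. x \<in> set xs \<Longrightarrow> a x = b x) \<Longrightarrow> weighted_sum p a xs = weighted_sum p b xs"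
  unfolding weighted_sum_def using link_sum_cong[of xs a b p] by simp

lemma weighted_sum_zero: "(\<And>x. x \<in> set xs \<Longrightarrow> a x = 0) \<Longrightarrow> weighted_sum p a xs = 0"
proof -
  assume "\<And>x. x \<in> set xs \<Longrightarrow> a x = 0"
  then have "weighted_sum p a xs = weighted_sum p (\<lambda>_. 0) xs" by (rule weighted_sum_cong)
  moreover have "link_sum p (\<lambda>_. 0) xs = 0" by (induction xs rule: induct_list012) auto
  ultimately show ?thesis by (simp add: weighted_sum_def)
qed

text \<open>
  The link across the cut is paid for by the two end terms that the shorter chains acquire there.
\<close>
lemma weighted_sum_append_le:
  assumes "0 \<le> p"
  shows "weighted_sum p a (xs @ ys) \<le> weighted_sum p a xs + weighted_sum p a ys"
proof (cases "xs = [] \<or> ys = []")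
  case True
  then show ?thesis by (auto simp: weighted_sum_def)
next
  case False
  then show ?thesis
    using abs_diff_powr_le[OF assms, of "a (last xs)" "a (hd ys)"]
    by (simp add: weighted_sum_def link_sum_append)
qed

lemma sorted_split_at:
  fixes xs :: "nat list"
  assumes "sorted_wrt (<) xs"
  obtains ys zs where "xs = ys @ zs" "sorted_wrt (<) ys" "sorted_wrt (<) zs"
    "\<forall>y\<in>set ys. y < n" "\<forall>z\<in>set zs. n \<le> z"
  using assms
proof (induction xs arbitrary: thesis)
  case Nil
  show ?case by (rule Nil(1)[of "[]" "[]"]) auto
next
  case (Cons x xs)
  show ?case
  proof (cases "x < n")
    case True
    from Cons.prems(2) have "sorted_wrt (<) xs" by simp
    then obtain ys zs where "xs = ys @ zs" "sorted_wrt (<) ys" "sorted_wrt (<) zs"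
      "\<forall>y\<in>set ys. y < n" "\<forall>z\<in>set zs. n \<le> z" using Cons.IH by blast
    then show ?thesis using True Cons.prems by (intro Cons.prems(1)[of "x # ys" zs]) auto
  next
    case False
    then show ?thesis using Cons.prems by (intro Cons.prems(1)[of "[]" "x # xs"]) auto
  qed
qed

text \<open>
  If \<open>a\<close> coincides with \<open>u\<close> below \<open>n\<close> and with \<open>v\<close> from \<open>n\<close> on, then cutting chains at \<open>n\<close> separates
  \<open>u\<close> from \<open>v\<close>.  All estimates for blocks, initial segments and tails are instances.
\<close>
lemma weighted_sum_glue_le:
  assumes p: "0 \<le> p" and xs: "sorted_wrt (<) xs"
    and u: "\<And>k. k < n \<Longrightarrow> a k = u k" and v: "\<And>k. n \<le> k \<Longrightarrow> a k = v k"
  obtains ys zs where "sorted_wrt (<) ys" "sorted_wrt (<) zs"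
    "\<forall>y\<in>set ys. y < n" "\<forall>z\<in>set zs. n \<le> z"
    "weighted_sum p a xs \<le> weighted_sum p u ys + weighted_sum p v zs"
proof -
  obtain ys zs where 1: "xs = ys @ zs" "sorted_wrt (<) ys" "sorted_wrt (<) zs"
    "\<forall>y\<in>set ys. y < n" "\<forall>z\<in>set zs. n \<le> z"
    by (rule sorted_split_at[OF xs, of n])
  have "weighted_sum p a ys = weighted_sum p u ys" "weighted_sum p a zs = weighted_sum p v zs"
    using 1 u v by (auto intro: weighted_sum_cong)
  then show thesis using 1 weighted_sum_append_le[OF p, of a ys zs] that by metis
qed

lemma link_sum_map_upt:
  "link_sum p a (map i [0..<Suc m]) = (\<Sum>j=1..m. \<bar>a (i (j - 1)) - a (i j)\<bar> powr p)"
proof (induction m)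
  case (Suc m)
  have "link_sum p a (map i [0..<Suc (Suc m)]) = link_sum p a (map i [0..<Suc m] @ [i (Suc m)])"
    by simp
  also have "\<dots> = link_sum p a (map i [0..<Suc m]) + \<bar>a (i m) - a (i (Suc m))\<bar> powr p"
    by (subst link_sum_append) (auto)
  finally show ?case using Suc by simp
qed simp

lemma cyclic_sum_le_weighted_sum:
  assumes "0 \<le> p"
  shows "cyclic_sum p a i m \<le> weighted_sum p a (map i [0..<Suc m])"
proof -
  have "hd (map i [0..<Suc m]) = i 0" by (simp add: hd_map del: upt_Suc)
  moreover have "last (map i [0..<Suc m]) = i m" by simp
  ultimately show ?thesis
    unfolding cyclic_sum_def weighted_sum_def link_sum_map_upt
    using abs_diff_powr_le[OF assms, of "a (i m)" "a (i 0)"] by simp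
qed

lemma continuous_on_weighted_sum:
  assumes "0 < p"
  shows "continuous_on UNIV (\<lambda>x. weighted_sum p x xs)"
proof -
  have pw: "continuous_on UNIV (\<lambda>x::nat \<Rightarrow> real. \<bar>h x\<bar> powr p)"
    if "continuous_on UNIV h" for h :: "(nat \<Rightarrow> real) \<Rightarrow> real"
    using assms that by (intro continuous_on_powr' continuous_intros) auto
  have "continuous_on UNIV (\<lambda>x. link_sum p x xs)"
    by (induction xs rule: induct_list012) (auto intro!: continuous_intros pw)
  then show ?thesis unfolding weighted_sum_def
    by (cases "xs = []") (auto intro!: continuous_intros pw)
qed

section \<open>The James space is a Banach space\<close>

locale james_exponent =
  fixes p :: real
  assumes p: "1 < p"
begin

text \<open>
  The factor \<open>2\<close>, here and below, is the \<open>p\<close>-th power of the factor \<open>2 powr (1/p)\<close> that normalises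
  the norm.
\<close>
lemma james_spaceI:
  assumes lim: "a \<longlonglongrightarrow> 0" and r: "0 \<le> r"
    and le: "\<And>i m. 1 \<le> m \<Longrightarrow> strict_mono_on {0..m} i \<Longrightarrow> cyclic_sum p a i m \<le> 2 * r powr p"
  shows "a \<in> vectors (james_space p)" "nrm (james_space p) a \<le> r"
proof -
  have "v \<le> 2 powr (1/p) * r" if "v \<in> cyclic_variations p a" for v
  proof -
    from that obtain i m where v: "v = cyclic_sum p a i m powr (1/p)"
      and im: "1 \<le> m" "strict_mono_on {0..m} i" by (auto simp: cyclic_variations_eq)
    have "v \<le> (2 * r powr p) powr (1/p)"
      unfolding v using p le[OF im] by (intro powr_mono2) (auto simp: cyclic_sum_nonneg)
    also have "\<dots> = 2 powr (1/p) * r" using p r by (simp add: powr_mult powr_powr)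
    finally show ?thesis .
  qed
  note * = this
  show "a \<in> vectors (james_space p)"
    using lim * by (auto simp: james_space_def bdd_above_def)
  have "Sup (cyclic_variations p a) \<le> 2 powr (1/p) * r"
    using cyclic_variations_nonempty * by (intro cSup_least) auto
  then show "nrm (james_space p) a \<le> r"
    by (simp add: james_space_def field_simps)
qed

lemma cyclic_root_le_james_norm:
  assumes "a \<in> vectors (james_space p)" "1 \<le> m" "strict_mono_on {0..m} i"
  shows "cyclic_sum p a i m powr (1/p) \<le> 2 powr (1/p) * nrm (james_space p) a"
proof -
  have "cyclic_sum p a i m powr (1/p) \<le> Sup (cyclic_variations p a)"
    using assms by (intro cSup_upper) (auto simp: james_space_def cyclic_variations_eq)
  then show ?thesis by (simp add: james_space_def)
qed

lemma james_norm_nonneg: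
  assumes "a \<in> vectors (james_space p)"
  shows "0 \<le> nrm (james_space p) a"
proof -
  have "0 \<le> 2 powr (1/p) * nrm (james_space p) a"
    using cyclic_root_le_james_norm[OF assms, of 1 id]
    by (smt (verit) order_refl powr_ge_zero strict_mono_on_def id_apply)
  then show ?thesis by (simp add: zero_le_mult_iff)
qed

lemma cyclic_sum_le_james_norm:
  assumes "a \<in> vectors (james_space p)" "1 \<le> m" "strict_mono_on {0..m} i"
  shows "cyclic_sum p a i m \<le> 2 * nrm (james_space p) a powr p"
proof -
  have "(cyclic_sum p a i m powr (1/p)) powr p \<le> (2 powr (1/p) * nrm (james_space p) a) powr p"
    using p cyclic_root_le_james_norm[OF assms] by (intro powr_mono2) auto
  then show ?thesis
    using p cyclic_sum_nonneg james_norm_nonneg[OF assms(1)] by (simp add: powr_mult powr_powr)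
qed

lemma james_space_tendsto: "a \<in> vectors (james_space p) \<Longrightarrow> a \<longlonglongrightarrow> 0"
  by (simp add: james_space_def)

text \<open>
  A chain of two indices counts their difference twice, once as a link and once as the closing
  term; this cancels the normalising factor of the norm.
\<close>
lemma james_norm_diff:
  assumes a: "a \<in> vectors (james_space p)"
  shows "\<bar>a s - a t\<bar> \<le> nrm (james_space p) a"
proof -
  have *: "\<bar>a s - a t\<bar> \<le> nrm (james_space p) a" if "s < t" for s t
  proof -
    define i where "i j = (if j = 0 then s else t)" for j :: nat
    have "strict_mono_on {0..1} i" using that by (auto simp: strict_mono_on_def i_def)
    from cyclic_sum_le_james_norm[OF a _ this]
    have "\<bar>a s - a t\<bar> powr p \<le> nrm (james_space p) a powr p"
      by (simp add: cyclic_sum_def i_def abs_minus_commute)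
    then show ?thesis
      using p james_norm_nonneg[OF a] by (smt (verit) powr_less_mono2)
  qed
  show ?thesis
    using *[of s t] *[of t s] james_norm_nonneg[OF a]
    by (cases s t rule: linorder_cases) (auto simp: abs_minus_commute)
qed

lemma james_norm_coordinate:
  assumes a: "a \<in> vectors (james_space p)"
  shows "\<bar>a s\<bar> \<le> nrm (james_space p) a"
proof (rule LIMSEQ_le_const2)
  show "(\<lambda>t. \<bar>a s - a t\<bar>) \<longlonglongrightarrow> \<bar>a s\<bar>"
    using tendsto_rabs[OF tendsto_diff[OF tendsto_const james_space_tendsto[OF a]], of "a s"] by simp
qed (use james_norm_diff[OF a] in auto)

lemma james_add:
  assumes a: "a \<in> vectors (james_space p)" and b: "b \<in> vectors (james_space p)"
  shows "a + b \<in> vectors (james_space p)"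
    "nrm (james_space p) (a + b) \<le> nrm (james_space p) a + nrm (james_space p) b"
proof -
  have lim: "(a + b) \<longlonglongrightarrow> 0"
    using tendsto_add[OF james_space_tendsto[OF a] james_space_tendsto[OF b]]
    by (simp add: plus_fun_def)
  have le: "cyclic_sum p (a + b) i m \<le> 2 * (nrm (james_space p) a + nrm (james_space p) b) powr p"
    if "1 \<le> m" "strict_mono_on {0..m} i" for i m
  proof -
    have "cyclic_sum p (a + b) i m powr (1/p)
        \<le> 2 powr (1/p) * (nrm (james_space p) a + nrm (james_space p) b)"
      using cyclic_sum_triangle[of p a b i m] p
        cyclic_root_le_james_norm[OF a that] cyclic_root_le_james_norm[OF b that]
      by (simp add: algebra_simps)
    then have "(cyclic_sum p (a + b) i m powr (1/p)) powr p
        \<le> (2 powr (1/p) * (nrm (james_space p) a + nrm (james_space p) b)) powr p"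
      using p by (intro powr_mono2) auto
    then show ?thesis
      using p cyclic_sum_nonneg[of p "a+b" i m] james_norm_nonneg[OF a] james_norm_nonneg[OF b]
      by (simp add: powr_mult powr_powr)
  qed
  show "a + b \<in> vectors (james_space p)"
    "nrm (james_space p) (a + b) \<le> nrm (james_space p) a + nrm (james_space p) b"
    using james_spaceI[OF lim _ le] james_norm_nonneg[OF a] james_norm_nonneg[OF b] by simp_all
qed

lemma james_scale_le:
  assumes a: "a \<in> vectors (james_space p)"
  shows "c *\<^sub>R a \<in> vectors (james_space p)"
    "nrm (james_space p) (c *\<^sub>R a) \<le> \<bar>c\<bar> * nrm (james_space p) a"
proof -
  have lim: "(c *\<^sub>R a) \<longlonglongrightarrow> 0"
    using tendsto_mult_left[OF james_space_tendsto[OF a], of c] by (simp add: scaleR_fun_def)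
  have le: "cyclic_sum p (c *\<^sub>R a) i m \<le> 2 * (\<bar>c\<bar> * nrm (james_space p) a) powr p"
    if "1 \<le> m" "strict_mono_on {0..m} i" for i m
  proof -
    have "cyclic_sum p (c *\<^sub>R a) i m \<le> \<bar>c\<bar> powr p * (2 * nrm (james_space p) a powr p)"
      unfolding cyclic_sum_scale using cyclic_sum_le_james_norm[OF a that]
      by (intro mult_left_mono) auto
    then show ?thesis using james_norm_nonneg[OF a] by (simp add: powr_mult mult_ac)
  qed
  show "c *\<^sub>R a \<in> vectors (james_space p)"
    "nrm (james_space p) (c *\<^sub>R a) \<le> \<bar>c\<bar> * nrm (james_space p) a"
    using james_spaceI[OF lim _ le] james_norm_nonneg[OF a] by simp_all
qed

lemma james_zero: "0 \<in> vectors (james_space p)" "nrm (james_space p) 0 = 0"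
proof -
  have "0 \<in> vectors (james_space p) \<and> nrm (james_space p) 0 \<le> 0"
    by (intro conjI james_spaceI[where r = 0]) (simp_all add: cyclic_sum_def zero_fun_def)
  then show "0 \<in> vectors (james_space p)" "nrm (james_space p) 0 = 0"
    using james_norm_nonneg by (auto intro: antisym)
qed

lemma james_normed_space: "is_normed_space (james_space p)"
  unfolding is_normed_space_def
proof (intro conjI ballI allI)
  show "subspace (vectors (james_space p))"
    by (auto simp: subspace_def james_zero james_add james_scale_le)
next
  fix a assume a: "a \<in> vectors (james_space p)"
  show "(nrm (james_space p) a = 0) = (a = 0)"
  proof
    assume "nrm (james_space p) a = 0"
    then show "a = 0" using james_norm_coordinate[OF a] by (simp add: fun_eq_iff)
  qed (simp add: james_zero)
next
  fix c :: real and a assume a: "a \<in> vectors (james_space p)"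
  show "nrm (james_space p) (c *\<^sub>R a) = \<bar>c\<bar> * nrm (james_space p) a"
  proof (cases "c = 0")
    case True
    then show ?thesis by (simp add: james_zero)
  next
    case False
    have "nrm (james_space p) a \<le> \<bar>1/c\<bar> * nrm (james_space p) (c *\<^sub>R a)"
      using james_scale_le(2)[OF james_scale_le(1)[OF a, of c], of "1/c"] False by simp
    then have "\<bar>c\<bar> * nrm (james_space p) a \<le> nrm (james_space p) (c *\<^sub>R a)"
      using False by (simp add: field_simps)
    then show ?thesis using james_scale_le(2)[OF a, of c] by simp
  qed
qed (rule james_add)

lemma james_diff:
  assumes "a \<in> vectors (james_space p)" "b \<in> vectors (james_space p)"
  shows "a - b \<in> vectors (james_space p)"
  using james_add(1)[OF assms(1) james_scale_le(1)[OF assms(2), of "-1"]] by simp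

text \<open>
  The coordinates of a Cauchy sequence converge, uniformly, to a null sequence \<open>x\<close>.  Each cyclic sum
  depends on finitely many coordinates, so the bound for \<open>s n - s k\<close> survives the limit in \<open>k\<close>.
\<close>
lemma james_banach_space: "is_banach_space (james_space p)"
  unfolding is_banach_space_def
proof (intro conjI james_normed_space allI impI, elim conjE)
  fix s :: "nat \<Rightarrow> nat \<Rightarrow> real"
  assume s: "\<forall>n. s n \<in> vectors (james_space p)"
    and cauchy: "\<forall>e>0. \<exists>N. \<forall>m\<ge>N. \<forall>n\<ge>N. nrm (james_space p) (s m - s n) < e"
  have d: "s m - s n \<in> vectors (james_space p)" for m n using s james_diff by blast
  have "\<exists>l. (\<lambda>n. s n k) \<longlonglongrightarrow> l" for k
  proof -
    have "Cauchy (\<lambda>n. s n k)"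
    proof (rule CauchyI)
      fix e :: real assume "0 < e"
      then obtain N where "\<forall>m\<ge>N. \<forall>n\<ge>N. nrm (james_space p) (s m - s n) < e" using cauchy by blast
      then show "\<exists>M. \<forall>m\<ge>M. \<forall>n\<ge>M. norm (s m k - s n k) < e"
        using le_less_trans[OF james_norm_coordinate[OF d]] by (intro exI[of _ N]) simp
    qed
    then show ?thesis using Cauchy_convergent_iff convergent_def by blast
  qed
  then obtain x where x: "\<And>k. (\<lambda>n. s n k) \<longlonglongrightarrow> x k" by metis
  have bound: "s n - x \<in> vectors (james_space p) \<and> nrm (james_space p) (s n - x) \<le> e"
    if e: "0 < e" and N: "\<forall>m\<ge>N. \<forall>n\<ge>N. nrm (james_space p) (s m - s n) < e" and n: "N \<le> n"
      and null: "(s n - x) \<longlonglongrightarrow> 0"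
    for e N n
  proof -
    have le: "cyclic_sum p (s n - x) i m \<le> 2 * e powr p"
      if im: "1 \<le> m" "strict_mono_on {0..m} i" for i m
    proof (rule LIMSEQ_le_const2)
      show "(\<lambda>k. cyclic_sum p (s n - s k) i m) \<longlonglongrightarrow> cyclic_sum p (s n - x) i m"
        unfolding cyclic_sum_def minus_apply using p
        by (intro tendsto_intros x tendsto_powr2) auto
      show "\<exists>M. \<forall>k\<ge>M. cyclic_sum p (s n - s k) i m \<le> 2 * e powr p"
      proof (intro exI allI impI)
        fix k assume "N \<le> k"
        then have "nrm (james_space p) (s n - s k) powr p \<le> e powr p"
          using N n p james_norm_nonneg[OF d] by (intro powr_mono2) (auto intro: less_imp_le)
        then show "cyclic_sum p (s n - s k) i m \<le> 2 * e powr p"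
          using cyclic_sum_le_james_norm[OF d im, of n k] by linarith
      qed
    qed
    show ?thesis using james_spaceI[OF null _ le] e by simp
  qed
  have unif: "\<bar>s n k - x k\<bar> \<le> e"
    if N: "\<forall>m\<ge>N. \<forall>n\<ge>N. nrm (james_space p) (s m - s n) < e" and n: "N \<le> n" for e N n k
  proof (rule LIMSEQ_le_const2)
    show "(\<lambda>j. \<bar>s n k - s j k\<bar>) \<longlonglongrightarrow> \<bar>s n k - x k\<bar>" by (intro tendsto_intros x)
    show "\<exists>M. \<forall>j\<ge>M. \<bar>s n k - s j k\<bar> \<le> e"
      using N n le_less_trans[OF james_norm_coordinate[OF d]]
      by (intro exI[of _ N] allI impI less_imp_le) simp
  qed
  have x0: "x \<longlonglongrightarrow> 0"
  proof (rule LIMSEQ_I)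
    fix r :: real assume r: "0 < r"
    then obtain N where N: "\<forall>m\<ge>N. \<forall>n\<ge>N. nrm (james_space p) (s m - s n) < r/2"
      using cauchy by (meson half_gt_zero)
    have "s N \<longlonglongrightarrow> 0" using s james_space_tendsto by blast
    then obtain M where "\<forall>k\<ge>M. norm (s N k - 0) < r/2" using LIMSEQ_D r half_gt_zero by blast
    then show "\<exists>M. \<forall>k\<ge>M. norm (x k - 0) < r"
      using unif[OF N order_refl] by (intro exI[of _ M]) (smt (verit) real_norm_def field_sum_of_halves)
  qed
  have null: "(s n - x) \<longlonglongrightarrow> 0" for n
    using tendsto_diff[OF james_space_tendsto x0, of "s n"] s by (simp add: fun_diff_def)
  obtain N where N: "\<forall>m\<ge>N. \<forall>n\<ge>N. nrm (james_space p) (s m - s n) < 1"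
    using cauchy zero_less_one by blast
  have "s N - x \<in> vectors (james_space p)"
    using bound[OF zero_less_one N order_refl null] by simp
  then have "s N - (s N - x) \<in> vectors (james_space p)" using s james_diff by blast
  then have x: "x \<in> vectors (james_space p)" by simp
  have "(\<lambda>n. nrm (james_space p) (s n - x)) \<longlonglongrightarrow> 0"
  proof (rule LIMSEQ_I)
    fix r :: real assume r: "0 < r"
    then obtain N where N: "\<forall>m\<ge>N. \<forall>n\<ge>N. nrm (james_space p) (s m - s n) < r/2"
      using cauchy by (meson half_gt_zero)
    have "norm (nrm (james_space p) (s n - x) - 0) < r" if "N \<le> n" for n
      using bound[OF _ N that null] james_norm_nonneg[of "s n - x"] r by auto
    then show "\<exists>N. \<forall>n\<ge>N. norm (nrm (james_space p) (s n - x) - 0) < r" by blast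
  qed
  with x show "\<exists>x\<in>vectors (james_space p). (\<lambda>n. nrm (james_space p) (s n - x)) \<longlonglongrightarrow> 0"
    by blast
qed

section \<open>Variation sums and the James norm\<close>

lemma link_sum_le_james_norm:
  assumes a: "a \<in> vectors (james_space p)" and xs: "sorted_wrt (<) xs"
  shows "link_sum p a xs \<le> 2 * nrm (james_space p) a powr p"
proof (cases "length xs \<le> 1")
  case True
  then have "link_sum p a xs = 0" by (cases "(p, a, xs)" rule: link_sum.cases) auto
  then show ?thesis by simp
next
  case False
  define m where "m = length xs - 1"
  have m: "1 \<le> m" "length xs = Suc m" using False by (auto simp: m_def)
  have "xs = map ((!) xs) [0..<Suc m]" using m(2) map_nth[of xs] by simp
  then have "link_sum p a xs = (\<Sum>j=1..m. \<bar>a (xs ! (j - 1)) - a (xs ! j)\<bar> powr p)"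
    using link_sum_map_upt[of p a "(!) xs" m] by simp
  also have "\<dots> \<le> cyclic_sum p a ((!) xs) m" by (simp add: cyclic_sum_def)
  also have "\<dots> \<le> 2 * nrm (james_space p) a powr p"
    using xs m by (intro cyclic_sum_le_james_norm[OF a]) (auto simp: monotone_on_def sorted_wrt_iff_nth_less)
  finally show ?thesis .
qed

text \<open>
  Comparison constant between the norm and the weighted sums: twice its \<open>p\<close>-th power is
  \<open>2 + 2 * 2\<^sup>p\<close>, the variation bound plus the weights of the two end terms.
\<close>
definition james_const :: real where "james_const = (1 + 2 powr p) powr (1/p)"

lemma james_const: "0 < james_const" "james_const powr p = 1 + 2 powr p"
  unfolding james_const_def using p by (auto simp: powr_powr add_nonneg_eq_0_iff intro!: add_pos_nonneg)

lemma weighted_sum_le_james_norm: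
  assumes a: "a \<in> vectors (james_space p)" and xs: "sorted_wrt (<) xs"
  shows "weighted_sum p a xs \<le> 2 * (james_const * nrm (james_space p) a) powr p"
proof -
  have *: "2 powr p * \<bar>a k\<bar> powr p \<le> 2 powr p * nrm (james_space p) a powr p" for k
    using james_norm_coordinate[OF a, of k] p by (intro mult_left_mono powr_mono2) auto
  have "weighted_sum p a xs \<le> 2 powr p * nrm (james_space p) a powr p
      + 2 * nrm (james_space p) a powr p + 2 powr p * nrm (james_space p) a powr p"
    using add_mono[OF add_mono[OF *[of "hd xs"] link_sum_le_james_norm[OF a xs]] *[of "last xs"]]
    by (simp add: weighted_sum_def)
  also have "\<dots> = 2 * (james_const * nrm (james_space p) a) powr p"
    using james_const james_norm_nonneg[OF a] by (simp add: powr_mult algebra_simps)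
  finally show ?thesis .
qed

text \<open>
  Conversely, weighted sums bound the norm, since the closing link of a cyclic sum is paid for by the
  end terms.
\<close>
lemma james_spaceI_weighted_sum:
  assumes "a \<longlonglongrightarrow> 0" "0 \<le> r"
    and le: "\<And>xs. sorted_wrt (<) xs \<Longrightarrow> weighted_sum p a xs \<le> 2 * r powr p"
  shows "a \<in> vectors (james_space p)" "nrm (james_space p) a \<le> r"
proof -
  have *: "cyclic_sum p a i m \<le> 2 * r powr p" if "strict_mono_on {0..m} i" for i m
  proof -
    have "sorted_wrt (<) (map i [0..<Suc m])"
      using that by (auto simp: sorted_wrt_iff_nth_less monotone_on_def simp del: upt_Suc)
    then show ?thesis using le cyclic_sum_le_weighted_sum[of p a i m] p by fastforce
  qed
  show "a \<in> vectors (james_space p)" "nrm (james_space p) a \<le> r"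
    using james_spaceI[OF assms(1,2)] * by blast+
qed

definition initial :: "nat \<Rightarrow> (nat \<Rightarrow> real) \<Rightarrow> nat \<Rightarrow> real" where
  "initial n a k = (if k < n then a k else 0)"

definition tail :: "nat \<Rightarrow> (nat \<Rightarrow> real) \<Rightarrow> nat \<Rightarrow> real" where
  "tail n a k = (if k < n then 0 else a k)"

lemma initial_plus_tail: "initial n a + tail n a = a"
  by (auto simp: initial_def tail_def fun_eq_iff)

lemma weighted_sum_initial_le:
  assumes "a \<in> vectors (james_space p)" "sorted_wrt (<) xs"
  shows "weighted_sum p (initial n a) xs \<le> 2 * (james_const * nrm (james_space p) a) powr p"
proof -
  obtain ys zs where "sorted_wrt (<) ys" "sorted_wrt (<) zs"
    "\<forall>y\<in>set ys. y < n" "\<forall>z\<in>set zs. n \<le> z"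
    "weighted_sum p (initial n a) xs \<le> weighted_sum p a ys + weighted_sum p (\<lambda>_. 0) zs"
    by (rule weighted_sum_glue_le[OF _ assms(2), of p n "initial n a" a "\<lambda>_. 0"])
      (use p in \<open>auto simp: initial_def\<close>)
  then show ?thesis
    using weighted_sum_le_james_norm[OF assms(1), of ys] weighted_sum_zero[of zs "\<lambda>_. 0" p] by simp
qed

lemma weighted_sum_tail_le:
  assumes "sorted_wrt (<) xs"
  obtains zs where "sorted_wrt (<) zs" "\<forall>z\<in>set zs. n \<le> z"
    "weighted_sum p (tail n a) xs \<le> weighted_sum p a zs"
proof -
  obtain ys zs where "sorted_wrt (<) ys" and zs: "sorted_wrt (<) zs"
    "\<forall>y\<in>set ys. y < n" "\<forall>z\<in>set zs. n \<le> z"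
    "weighted_sum p (tail n a) xs \<le> weighted_sum p (\<lambda>_. 0) ys + weighted_sum p a zs"
    by (rule weighted_sum_glue_le[OF _ assms, of p n "tail n a" "\<lambda>_. 0" a])
      (use p in \<open>auto simp: tail_def\<close>)
  then show thesis using that[of zs] weighted_sum_zero[of ys "\<lambda>_. 0" p] by simp
qed

lemma finite_support_tendsto: "(\<And>k. n \<le> k \<Longrightarrow> a k = 0) \<Longrightarrow> a \<longlonglongrightarrow> (0::real)"
  by (intro tendsto_eventually eventually_sequentiallyI[of n])

text \<open>
  Below the end of the support there are only finitely many chains.
\<close>
lemma finite_support_in_james:
  assumes "\<And>k. n \<le> k \<Longrightarrow> a k = 0"
  shows "a \<in> vectors (james_space p)"
proof -
  define L where "L = {ys. set ys \<subseteq> {..<n} \<and> distinct ys}"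
  have fin: "finite (weighted_sum p a ` L)" unfolding L_def by (simp add: finite_subset_distinct)
  define R where "R = Max (weighted_sum p a ` L)"
  have le_R: "weighted_sum p a ys \<le> R" if "ys \<in> L" for ys
    unfolding R_def using fin that by (intro Max_ge) auto
  have R: "0 \<le> R" using le_R[of "[]"] by (simp add: L_def weighted_sum_def)
  have "weighted_sum p a xs \<le> 2 * ((R/2) powr (1/p)) powr p" if xs: "sorted_wrt (<) xs" for xs
  proof -
    obtain ys zs where "sorted_wrt (<) ys" "sorted_wrt (<) zs"
      "\<forall>y\<in>set ys. y < n" "\<forall>z\<in>set zs. n \<le> z"
      "weighted_sum p a xs \<le> weighted_sum p a ys + weighted_sum p (\<lambda>_. 0) zs"
      by (rule weighted_sum_glue_le[OF _ xs, of p n a a "\<lambda>_. 0"]) (use p assms in auto)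
    moreover from this have "ys \<in> L" by (auto simp: L_def strict_sorted_iff)
    ultimately have "weighted_sum p a xs \<le> R"
      using le_R[of ys] weighted_sum_zero[of zs "\<lambda>_. 0" p] by simp
    then show ?thesis using R p by (simp add: powr_powr)
  qed
  then show ?thesis
    using finite_support_tendsto[of n a] assms
    by (intro james_spaceI_weighted_sum(1)[where r = "(R/2) powr (1/p)"]) auto
qed

lemma initial_in_james: "initial n a \<in> vectors (james_space p)"
  by (rule finite_support_in_james[of n]) (simp add: initial_def)

lemma tail_in_james:
  assumes a: "a \<in> vectors (james_space p)"
  shows "tail n a \<in> vectors (james_space p)"
    "nrm (james_space p) (tail n a) \<le> james_const * nrm (james_space p) a"
proof -
  have lim: "tail n a \<longlonglongrightarrow> 0"
    using james_space_tendsto[OF a]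
    by (rule Lim_transform_eventually) (auto simp: tail_def intro!: eventually_sequentiallyI[of n])
  have le: "weighted_sum p (tail n a) xs \<le> 2 * (james_const * nrm (james_space p) a) powr p"
    if xs: "sorted_wrt (<) xs" for xs
    using weighted_sum_tail_le[OF xs, of n a] weighted_sum_le_james_norm[OF a]
    by (metis order_trans)
  show "tail n a \<in> vectors (james_space p)"
    "nrm (james_space p) (tail n a) \<le> james_const * nrm (james_space p) a"
    using james_spaceI_weighted_sum[OF lim _ le] james_const(1) james_norm_nonneg[OF a] by auto
qed

text \<open>
  Take a chain whose variation sum is within \<open>e/3\<close> of the supremum.  Appending a chain that lies beyond
  it can increase the sum by at most \<open>e/3\<close>, and the end terms are small because \<open>a\<close> tends to \<open>0\<close>.
\<close>
lemma weighted_sum_far_out_small: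
  assumes a: "a \<in> vectors (james_space p)" and e: "0 < e"
  obtains N where "\<And>xs. sorted_wrt (<) xs \<Longrightarrow> (\<And>x. x \<in> set xs \<Longrightarrow> N \<le> x) \<Longrightarrow> weighted_sum p a xs \<le> e"
proof -
  define S where "S = (SUP xs\<in>{xs. sorted_wrt (<) xs}. link_sum p a xs)"
  have bdd: "bdd_above (link_sum p a ` {xs. sorted_wrt (<) xs})"
    using link_sum_le_james_norm[OF a] by (intro bdd_aboveI2) auto
  have "S - e/3 < S" using e by simp
  then obtain ws where ws: "sorted_wrt (<) ws" "S - e/3 < link_sum p a ws"
    unfolding S_def using bdd by (subst (asm) less_cSUP_iff) (auto intro: exI[of _ "[]"])
  have "(\<lambda>k. 2 powr p * \<bar>a k\<bar> powr p) \<longlonglongrightarrow> 2 powr p * \<bar>0\<bar> powr p"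
    using p james_space_tendsto[OF a] by (intro tendsto_intros tendsto_powr2) auto
  then have "\<forall>\<^sub>F k in sequentially. 2 powr p * \<bar>a k\<bar> powr p < e/3"
    using e by (intro order_tendstoD(2)[where y = "2 powr p * \<bar>0\<bar> powr p"]) auto
  then obtain N1 where N1: "\<And>k. N1 \<le> k \<Longrightarrow> 2 powr p * \<bar>a k\<bar> powr p < e/3"
    by (auto simp: eventually_sequentially)
  obtain N2 where N2: "\<And>w. w \<in> set ws \<Longrightarrow> w < N2"
    using finite_nat_set_iff_bounded[of "set ws"] by auto
  show thesis
  proof (rule that[of "max N1 N2"])
    fix xs :: "nat list"
    assume xs: "sorted_wrt (<) xs" "\<And>x. x \<in> set xs \<Longrightarrow> max N1 N2 \<le> x"
    show "weighted_sum p a xs \<le> e"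
    proof (cases "xs = []")
      case True
      then show ?thesis using e by (simp add: weighted_sum_def)
    next
      case False
      have "sorted_wrt (<) (ws @ xs)"
        using ws xs N2 by (fastforce simp: sorted_wrt_append)
      then have "link_sum p a (ws @ xs) \<le> S"
        unfolding S_def using bdd by (intro cSUP_upper) auto
      then have "link_sum p a xs \<le> e/3" using link_sum_append_ge[of p a ws xs] ws by linarith
      then show ?thesis
        using False N1[of "hd xs"] N1[of "last xs"] xs(2)[of "hd xs"] xs(2)[of "last xs"]
        by (simp add: weighted_sum_def)
    qed
  qed
qed

text \<open>
  In classical terms, the unit vectors form a basis.
\<close>
lemma james_norm_tail_small:
  assumes a: "a \<in> vectors (james_space p)" and e: "0 < e"
  obtains N where "\<And>n. N \<le> n \<Longrightarrow> nrm (james_space p) (tail n a) \<le> e"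
proof -
  have "0 < 2 * e powr p" using e by simp
  from weighted_sum_far_out_small[OF a this] obtain N where N:
    "\<And>xs. sorted_wrt (<) xs \<Longrightarrow> (\<And>x. x \<in> set xs \<Longrightarrow> N \<le> x) \<Longrightarrow> weighted_sum p a xs \<le> 2 * e powr p"
    by blast
  show thesis
  proof (rule that)
    fix n assume n: "N \<le> n"
    show "nrm (james_space p) (tail n a) \<le> e"
    proof (rule james_spaceI_weighted_sum(2))
      fix xs :: "nat list" assume "sorted_wrt (<) xs"
      then obtain zs where "sorted_wrt (<) zs" "\<forall>z\<in>set zs. n \<le> z"
        "weighted_sum p (tail n a) xs \<le> weighted_sum p a zs"
        by (rule weighted_sum_tail_le)
      then show "weighted_sum p (tail n a) xs \<le> 2 * e powr p"
        using N[of zs] n order_trans by fastforce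
    qed (use e james_space_tendsto tail_in_james(1)[OF a] in auto)
  qed
qed

section \<open>Functionals on the James space are small on tails\<close>

lemma james_dual_zero: "f \<in> vectors (dual (james_space p)) \<Longrightarrow> f 0 = 0"
  using dualD(2)[OF _ james_zero(1), of f 0] by simp

lemma james_dual_bounded:
  assumes "f \<in> vectors (dual (james_space p))"
  obtains B where "0 < B" "\<And>a. a \<in> vectors (james_space p) \<Longrightarrow> \<bar>f a\<bar> \<le> B * nrm (james_space p) a"
proof -
  obtain B where B: "\<And>a. a \<in> vectors (james_space p) \<Longrightarrow> \<bar>f a\<bar> \<le> B * nrm (james_space p) a"
    using dualD(4)[OF assms] by blast
  show thesis
  proof (rule that[of "max B 1"])
    fix a assume a: "a \<in> vectors (james_space p)"
    have "B * nrm (james_space p) a \<le> max B 1 * nrm (james_space p) a"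
      using james_norm_nonneg[OF a] by (intro mult_right_mono) auto
    then show "\<bar>f a\<bar> \<le> max B 1 * nrm (james_space p) a" using B[OF a] by linarith
  qed simp
qed

lemma james_dual_initial:
  assumes f: "f \<in> vectors (dual (james_space p))" and a: "a \<in> vectors (james_space p)"
  shows "f a = f (initial n a) + f (tail n a)"
  using dualD(1)[OF f initial_in_james[of n a] tail_in_james(1)[OF a, of n]]
  by (simp add: initial_plus_tail)

definition coordinate_unit :: "nat \<Rightarrow> nat \<Rightarrow> real" where
  "coordinate_unit k j = (if j = k then 1 else 0)"

lemma initial_Suc: "initial (Suc n) a = initial n a + a n *\<^sub>R coordinate_unit n"
  by (auto simp: fun_eq_iff initial_def coordinate_unit_def scaleR_fun_def less_Suc_eq)

lemma james_dual_initial_sum: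
  assumes f: "f \<in> vectors (dual (james_space p))"
  shows "f (initial n a) = (\<Sum>k<n. a k * f (coordinate_unit k))"
proof (induction n)
  case 0
  have "initial 0 a = 0" by (simp add: initial_def fun_eq_iff)
  then have "f (initial 0 a) = 0" using james_dual_zero[OF f] by metis
  then show ?case by simp
next
  case (Suc n)
  have unit: "coordinate_unit n \<in> vectors (james_space p)"
    by (rule finite_support_in_james[of "Suc n"]) (simp add: coordinate_unit_def)
  have "f (initial (Suc n) a) = f (initial n a) + a n * f (coordinate_unit n)"
    unfolding initial_Suc dualD(1)[OF f initial_in_james james_scale_le(1)[OF unit]]
      dualD(2)[OF f unit] ..
  then show ?case using Suc by simp
qed

text \<open>
  Truncating a vector at which \<open>f\<close> is large changes the value of \<open>f\<close> little and produces a block whose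
  weighted sums are bounded independently of the block.
\<close>
lemma james_large_block:
  assumes f: "f \<in> vectors (dual (james_space p))" and e: "0 < e"
    and x: "x \<in> vectors (james_space p)" "\<forall>k<n. x k = 0" "nrm (james_space p) x \<le> 1" "e < \<bar>f x\<bar>"
  obtains u m where "u \<in> vectors (james_space p)" "\<forall>k<n. u k = 0" "\<forall>k\<ge>m. u k = 0" "e < f u"
    "\<And>xs. sorted_wrt (<) xs \<Longrightarrow> weighted_sum p u xs \<le> 2 * james_const powr p"
proof -
  define y where "y = (if 0 < f x then x else (-1) *\<^sub>R x)"
  have y: "y \<in> vectors (james_space p)" "\<forall>k<n. y k = 0" "nrm (james_space p) y \<le> 1" "e < f y"
    using x e james_scale_le[OF x(1), of "-1"] dualD(2)[OF f x(1), of "-1"]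
    by (auto simp: y_def scaleR_fun_def)
  obtain B where B: "0 < B"
    "\<And>a. a \<in> vectors (james_space p) \<Longrightarrow> \<bar>f a\<bar> \<le> B * nrm (james_space p) a"
    by (rule james_dual_bounded[OF f]) blast
  have "0 < (f y - e) / (2 * B)" using y B by simp
  from james_norm_tail_small[OF y(1) this]
  obtain m where m: "nrm (james_space p) (tail m y) \<le> (f y - e) / (2 * B)" by blast
  have "B * nrm (james_space p) (tail m y) \<le> (f y - e) / 2"
    using mult_left_mono[OF m, of B] B by simp
  then have "\<bar>f (tail m y)\<bar> \<le> (f y - e) / 2"
    using B(2)[OF tail_in_james(1)[OF y(1), of m]] by (rule order_trans[rotated])
  then have "\<bar>f (tail m y)\<bar> < f y - e" using y(4) by simp
  then have "e < f (initial m y)" using james_dual_initial[OF f y(1), of m] by linarith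
  moreover have "weighted_sum p (initial m y) xs \<le> 2 * james_const powr p"
    if "sorted_wrt (<) xs" for xs
  proof -
    have "(james_const * nrm (james_space p) y) powr p \<le> james_const powr p"
      using y james_norm_nonneg[OF y(1)] james_const(1) p
      by (intro powr_mono2) (auto simp: mult_left_le)
    then show ?thesis using weighted_sum_initial_le[OF y(1) that, of m] by linarith
  qed
  moreover have "\<forall>k<n. initial m y k = 0" "\<forall>k\<ge>m. initial m y k = 0"
    using y by (auto simp: initial_def)
  ultimately show thesis using that initial_in_james by blast
qed

text \<open>
  The basis is shrinking.  Otherwise, blocks as in \<open>james_large_block\<close> can be chosen one behind the
  other; after \<open>N\<close> steps their sum \<open>v\<close> has weighted sums at most \<open>N R\<close>, hence norm at most
  \<open>(N R / 2)\<^bsup>1/p\<^esup>\<close>, while \<open>f v \<ge> N e\<close>.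
\<close>
lemma james_dual_tail_small:
  assumes f: "f \<in> vectors (dual (james_space p))" and e: "0 < e"
  obtains n where "\<And>x. x \<in> vectors (james_space p) \<Longrightarrow> \<forall>k<n. x k = 0 \<Longrightarrow> \<bar>f x\<bar> \<le> e * nrm (james_space p) x"
proof (rule ccontr)
  assume no: "\<not> thesis"
  define R where "R = 2 * james_const powr p"
  have R: "0 < R" using james_const(1) by (simp add: R_def)
  have bad: "\<exists>x. x \<in> vectors (james_space p) \<and> (\<forall>k<n. x k = 0) \<and> nrm (james_space p) x \<le> 1 \<and> e < \<bar>f x\<bar>"
    for n
  proof -
    have "\<not> (\<forall>x. x \<in> vectors (james_space p) \<longrightarrow> (\<forall>k<n. x k = 0) \<longrightarrow> \<bar>f x\<bar> \<le> e * nrm (james_space p) x)"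
      using no that[of n] by blast
    then obtain x where x: "x \<in> vectors (james_space p)" "\<forall>k<n. x k = 0" "e * nrm (james_space p) x < \<bar>f x\<bar>"
      by (auto simp: not_le)
    define r where "r = nrm (james_space p) x"
    have "0 < r"
    proof -
      have "r \<noteq> 0"
      proof
        assume "r = 0"
        then have "x = 0" using james_norm_coordinate[OF x(1)] by (simp add: r_def fun_eq_iff)
        then show False using x(3) james_dual_zero[OF f] james_zero by simp
      qed
      then show ?thesis using james_norm_nonneg[OF x(1)] by (simp add: r_def)
    qed
    then have "nrm (james_space p) ((1/r) *\<^sub>R x) \<le> 1" "\<forall>k<n. ((1/r) *\<^sub>R x) k = 0"
      using james_scale_le(2)[OF x(1), of "1/r"] x(2)
      by (auto simp: r_def[symmetric] scaleR_fun_def)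
    moreover have "e < \<bar>f ((1/r) *\<^sub>R x)\<bar>"
      unfolding dualD(2)[OF f x(1)]
      using x(3) \<open>0 < r\<close> by (simp add: r_def[symmetric] abs_mult field_simps)
    ultimately show ?thesis using james_scale_le(1)[OF x(1)] by blast
  qed
  have blocks: "\<exists>v m. v \<in> vectors (james_space p) \<and> (\<forall>k\<ge>m. v k = 0) \<and> real N * e \<le> f v \<and>
      (\<forall>xs. sorted_wrt (<) xs \<longrightarrow> weighted_sum p v xs \<le> real N * R)" for N
  proof (induction N)
    case 0
    have "\<forall>k\<ge>0. (0 :: nat \<Rightarrow> real) k = 0" by simp
    moreover have "real 0 * e \<le> f 0" using james_dual_zero[OF f] by simp
    moreover have "\<forall>xs. sorted_wrt (<) xs \<longrightarrow> weighted_sum p 0 xs \<le> real 0 * R"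
      using weighted_sum_zero[of _ 0 p] by simp
    ultimately show ?case using james_zero(1) by blast
  next
    case (Suc N)
    then obtain v n where v: "v \<in> vectors (james_space p)" "\<forall>k\<ge>n. v k = 0" "real N * e \<le> f v"
      "\<And>xs. sorted_wrt (<) xs \<Longrightarrow> weighted_sum p v xs \<le> real N * R" by blast
    obtain x where x: "x \<in> vectors (james_space p)" "\<forall>k<n. x k = 0" "nrm (james_space p) x \<le> 1" "e < \<bar>f x\<bar>"
      using bad[of n] by blast
    obtain u m where u: "u \<in> vectors (james_space p)" "\<forall>k<n. u k = 0" "\<forall>k\<ge>m. u k = 0" "e < f u"
      "\<And>xs. sorted_wrt (<) xs \<Longrightarrow> weighted_sum p u xs \<le> R"
      using james_large_block[OF f e x] unfolding R_def by blast
    have "weighted_sum p (v + u) xs \<le> real (Suc N) * R" if xs: "sorted_wrt (<) xs" for xs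
    proof -
      obtain ys zs where "sorted_wrt (<) ys" "sorted_wrt (<) zs"
        "\<forall>y\<in>set ys. y < n" "\<forall>z\<in>set zs. n \<le> z"
        "weighted_sum p (v + u) xs \<le> weighted_sum p v ys + weighted_sum p u zs"
        by (rule weighted_sum_glue_le[OF _ xs, of p n "v + u" v u]) (use u v p in auto)
      then show ?thesis using v(4)[of ys] u(5)[of zs] by (simp add: algebra_simps)
    qed
    moreover have "\<forall>k\<ge>max n m. (v + u) k = 0" using u v by simp
    moreover have "real (Suc N) * e \<le> f (v + u)"
      using dualD(1)[OF f v(1) u(1)] u(4) v(3) by (simp add: algebra_simps)
    ultimately show ?case using james_add(1)[OF v(1) u(1)] by blast
  qed
  obtain B where B: "0 < B"
    "\<And>a. a \<in> vectors (james_space p) \<Longrightarrow> \<bar>f a\<bar> \<le> B * nrm (james_space p) a"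
    by (rule james_dual_bounded[OF f]) blast
  (* f v lies between N e and B times the norm of v, which is at most (N R / 2)^(1/p) *)
  define c where "c = B * (R/2) powr (1/p) / e"
  have c: "0 < c" using B R e by (simp add: c_def)
  have growth: "real N \<le> c * real N powr (1/p)" for N
  proof -
    obtain v m where v: "v \<in> vectors (james_space p)" "real N * e \<le> f v"
      "\<And>xs. sorted_wrt (<) xs \<Longrightarrow> weighted_sum p v xs \<le> real N * R" using blocks[of N] by blast
    have "2 * ((real N * R / 2) powr (1/p)) powr p = real N * R"
      using R p by (simp add: powr_powr)
    then have "nrm (james_space p) v \<le> (real N * R / 2) powr (1/p)"
      using v by (intro james_spaceI_weighted_sum(2) james_space_tendsto) auto
    also have "\<dots> = real N powr (1/p) * (R/2) powr (1/p)"
      using R by (simp flip: powr_mult)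
    finally have "B * nrm (james_space p) v \<le> B * (real N powr (1/p) * (R/2) powr (1/p))"
      using B by (intro mult_left_mono) auto
    then have "real N * e \<le> B * (real N powr (1/p) * (R/2) powr (1/p))"
      using v(2) B(2)[OF v(1)] by linarith
    then show ?thesis using e by (simp add: c_def field_simps)
  qed
  (* growth says N^s <= c with s = 1 - 1/p > 0; this fails once N exceeds c^(1/s) *)
  define s where "s = 1 - 1/p"
  have s: "0 < s" using p by (simp add: s_def)
  obtain N :: nat where N: "c powr (1/s) < real N" using reals_Archimedean2 by blast
  have N0: "0 < real N" using N powr_ge_zero[of c "1/s"] by linarith
  have "c = (c powr (1/s)) powr s" using c s by (simp add: powr_powr)
  also have "\<dots> < real N powr s" using N s by (intro powr_less_mono2) auto
  finally have "c * real N powr (1/p) < real N powr s * real N powr (1/p)"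
    using N0 by simp
  also have "\<dots> = real N" using N0 by (simp add: s_def flip: powr_add)
  finally show False using growth[of N] by simp
qed

text \<open>
  On \<open>C\<close>, the functional is the uniform limit of the maps that evaluate it at initial segments, and each of
  these depends on finitely many coordinates only.
\<close>
lemma james_dual_pointwise_continuous:
  assumes f: "f \<in> vectors (dual (james_space p))"
    and C: "C \<subseteq> vectors (james_space p)" "\<And>x. x \<in> C \<Longrightarrow> nrm (james_space p) x \<le> R"
  shows "continuous_on C f"
proof (rule uniform_limit_theorem)
  show "\<forall>\<^sub>F n in sequentially. continuous_on C (\<lambda>x. f (initial n x))"
    unfolding james_dual_initial_sum[OF f]
    by (intro always_eventually allI continuous_intros continuous_on_product_then_coordinatewise)
  show "uniform_limit C (\<lambda>n x. f (initial n x)) f sequentially"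
  proof (rule uniform_limitI)
    fix e :: real assume e: "0 < e"
    (* max R 1 is a positive bound of the norm, and tails are at most james_const times longer *)
    define d where "d = e / (2 * james_const * max R 1)"
    have d: "0 < d" "d * (james_const * max R 1) < e"
      using e james_const(1) by (auto simp: d_def field_simps)
    obtain n0 where n0: "\<And>x. x \<in> vectors (james_space p) \<Longrightarrow> \<forall>k<n0. x k = 0 \<Longrightarrow> \<bar>f x\<bar> \<le> d * nrm (james_space p) x"
      using james_dual_tail_small[OF f d(1)] by blast
    have "dist (f (initial n x)) (f x) < e" if n: "n0 \<le> n" and x: "x \<in> C" for n x
    proof -
      have xJ: "x \<in> vectors (james_space p)" using C x by auto
      have "\<bar>f (tail n x)\<bar> \<le> d * nrm (james_space p) (tail n x)"
        using n by (intro n0 tail_in_james xJ) (auto simp: tail_def)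
      also have "\<dots> \<le> d * (james_const * max R 1)"
        using tail_in_james(2)[OF xJ, of n] C(2)[OF x] d james_const(1)
        by (intro mult_left_mono order_trans[OF tail_in_james(2)[OF xJ]]) auto
      finally show ?thesis
        using d(2) james_dual_initial[OF f xJ, of n] by (simp add: dist_real_def)
    qed
    then show "\<forall>\<^sub>F n in sequentially. \<forall>x\<in>C. dist (f (initial n x)) (f x) < e"
      by (auto simp: eventually_sequentially)
  qed
qed simp

section \<open>Sets on which weakly summable sequences of functionals vanish uniformly\<close>

lemma closure_weighted_sum_le:
  assumes "\<And>y. y \<in> K \<Longrightarrow> weighted_sum p y xs \<le> R" "x \<in> closure K"
  shows "weighted_sum p x xs \<le> R"
proof -
  have "closed {x. weighted_sum p x xs \<le> R}"
    using p by (intro closed_Collect_le continuous_on_weighted_sum) auto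
  then have "closure K \<subseteq> {x. weighted_sum p x xs \<le> R}"
    using assms(1) by (intro closure_minimal) auto
  then show ?thesis using assms(2) by blast
qed

text \<open>
  Infinitely many coordinates of \<open>x\<close> are large.  A member of \<open>K\<close> that is close to \<open>x\<close> at such a coordinate
  is large there too, but becomes small later on.
\<close>
lemma oscillation_of_nonnull_closure_point:
  assumes K: "K \<subseteq> vectors (james_space p)" and x: "x \<in> closure K" and nonnull: "\<not> x \<longlonglongrightarrow> 0"
  obtains \<delta> where "0 < \<delta>" "\<And>N. \<exists>y n m. y \<in> K \<and> N \<le> n \<and> n < m \<and> \<delta> \<le> \<bar>y n - y m\<bar>"
proof -
  obtain r where r: "0 < r" and far: "\<And>N. \<exists>n\<ge>N. r \<le> \<bar>x n\<bar>"
    using nonnull by (auto simp: LIMSEQ_iff not_less)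
  have "\<exists>y n m. y \<in> K \<and> N \<le> n \<and> n < m \<and> r/4 \<le> \<bar>y n - y m\<bar>" for N
  proof -
    obtain n where n: "N \<le> n" "r \<le> \<bar>x n\<bar>" using far by blast
    obtain y where y: "y \<in> K" "\<bar>y n - x n\<bar> < r/2"
      using pointwise_closure_approx[OF x, of "r/2" n] r by auto
    have "y \<longlonglongrightarrow> 0" using K y james_space_tendsto by blast
    then obtain M where M: "\<And>m. M \<le> m \<Longrightarrow> \<bar>y m\<bar> < r/4"
      using LIMSEQ_D[of y 0 "r/4"] r by auto
    have "r/4 \<le> \<bar>y n - y (max M (Suc n))\<bar>"
      using M[of "max M (Suc n)"] n y by linarith
    then show ?thesis using y n by (intro exI[of _ y] exI[of _ n] exI[of _ "max M (Suc n)"]) auto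
  qed
  then show thesis using that[of "r/4"] r by simp
qed

definition difference_functional :: "nat \<Rightarrow> nat \<Rightarrow> (nat \<Rightarrow> real) \<Rightarrow> real" where
  "difference_functional n m x = (if x \<in> vectors (james_space p) then x n - x m else 0)"

lemma difference_functional_dual: "difference_functional n m \<in> vectors (dual (james_space p))"
proof -
  have "\<bar>difference_functional n m x\<bar> \<le> 1 * nrm (james_space p) x"
    if "x \<in> vectors (james_space p)" for x
    using james_norm_diff that by (simp add: difference_functional_def)
  then show ?thesis
    using james_add(1) james_scale_le(1)
    by (intro dualI[where B = 1]) (auto simp: difference_functional_def scaleR_fun_def algebra_simps)
qed

text \<open>
  The differences are links of the single chain \<open>n 0 < m 0 < n 1 < m 1 < \<dots>\<close>.
\<close>
lemma weakly_p_summable_differences: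
  assumes n: "\<And>j. n j < m j" and m: "\<And>j. m j < n (Suc j)"
  shows "weakly_p_summable p (dual (james_space p)) (\<lambda>j. difference_functional (n j) (m j))"
proof (rule weakly_p_summable_dualI[OF p james_normed_space difference_functional_dual])
  fix x N assume x: "x \<in> vectors (james_space p)" "nrm (james_space p) x \<le> 1"
  have chain: "\<exists>xs. sorted_wrt (<) xs \<and> (\<forall>k\<in>set xs. k < n N) \<and>
      (\<Sum>j<N. \<bar>x (n j) - x (m j)\<bar> powr p) \<le> link_sum p x xs" for N
  proof (induction N)
    case 0
    show ?case by (intro exI[of _ "[]"]) auto
  next
    case (Suc N)
    then obtain xs where xs: "sorted_wrt (<) xs" "\<forall>k\<in>set xs. k < n N"
      "(\<Sum>j<N. \<bar>x (n j) - x (m j)\<bar> powr p) \<le> link_sum p x xs" by blast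
    have "sorted_wrt (<) (xs @ [n N, m N])" "\<forall>k\<in>set (xs @ [n N, m N]). k < n (Suc N)"
      using xs n[of N] m[of N] by (auto simp: sorted_wrt_append intro: less_trans)
    moreover have "(\<Sum>j<Suc N. \<bar>x (n j) - x (m j)\<bar> powr p) \<le> link_sum p x (xs @ [n N, m N])"
      using link_sum_append_ge[of p x xs "[n N, m N]"] xs(3) by simp
    ultimately show ?case by blast
  qed
  then obtain xs where xs: "sorted_wrt (<) xs"
    "(\<Sum>j<N. \<bar>x (n j) - x (m j)\<bar> powr p) \<le> link_sum p x xs" by blast
  have "nrm (james_space p) x powr p \<le> 1 powr p"
    using x james_norm_nonneg[OF x(1)] p by (intro powr_mono2) auto
  then show "(\<Sum>j<N. \<bar>difference_functional (n j) (m j) x\<bar> powr p) \<le> 2"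
    using xs(2) link_sum_le_james_norm[OF x(1) xs(1)] x(1) by (simp add: difference_functional_def)
qed

text \<open>
  The gliding hump: the oscillating pairs can be chosen one behind the other, and the corresponding
  differences are weakly \<open>p\<close>-summable functionals that are not uniformly small on \<open>K\<close>.
\<close>
lemma p_Vstar_closure_null:
  assumes K: "p_Vstar_set p (james_space p) K" and x: "x \<in> closure K"
  shows "x \<longlonglongrightarrow> 0"
proof (rule ccontr)
  assume nonnull: "\<not> x \<longlonglongrightarrow> 0"
  have KJ: "K \<subseteq> vectors (james_space p)" using K by (simp add: p_Vstar_set_def)
  obtain \<delta> where \<delta>: "0 < \<delta>"
    and osc: "\<And>N. \<exists>y n m. y \<in> K \<and> N \<le> n \<and> n < m \<and> \<delta> \<le> \<bar>y n - y m\<bar>"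
    by (rule oscillation_of_nonnull_closure_point[OF KJ x nonnull]) blast
  from osc obtain Y n0 m0 where Y: "\<And>N. Y N \<in> K" "\<And>N. N \<le> n0 N" "\<And>N. n0 N < m0 N"
    "\<And>N. \<delta> \<le> \<bar>Y N (n0 N) - Y N (m0 N)\<bar>" by metis
  (* s j is the point from which the j-th pair is chosen: just beyond the previous pair *)
  define s where "s = rec_nat 0 (\<lambda>_ k. Suc (m0 k))"
  have s: "s (Suc j) = Suc (m0 (s j))" for j by (simp add: s_def)
  have "m0 (s j) < n0 (s (Suc j))" for j using Y(2)[of "s (Suc j)"] s[of j] by simp
  then have "weakly_p_summable p (dual (james_space p)) (\<lambda>j. difference_functional (n0 (s j)) (m0 (s j)))"
    by (intro weakly_p_summable_differences Y)
  then have "(\<lambda>j. SUP y\<in>K. ennreal \<bar>difference_functional (n0 (s j)) (m0 (s j)) y\<bar>) \<longlonglongrightarrow> 0"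
    using K by (simp add: p_Vstar_set_def)
  moreover have "ennreal \<delta> \<le> (SUP y\<in>K. ennreal \<bar>difference_functional (n0 (s j)) (m0 (s j)) y\<bar>)" for j
  proof (rule SUP_upper2[OF Y(1)[of "s j"]])
    have "\<delta> \<le> \<bar>difference_functional (n0 (s j)) (m0 (s j)) (Y (s j))\<bar>"
      using Y(1,4)[of "s j"] KJ by (auto simp: difference_functional_def)
    then show "ennreal \<delta> \<le> ennreal \<bar>difference_functional (n0 (s j)) (m0 (s j)) (Y (s j))\<bar>"
      by (rule ennreal_leI)
  qed
  ultimately have "ennreal \<delta> \<le> 0" by (intro LIMSEQ_le_const) auto
  then show False using \<delta> by simp
qed

text \<open>
  Boundedness of the weighted sums is a closed condition; membership in the space needs in addition that
  the points of the closure tend to \<open>0\<close>.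
\<close>
lemma p_Vstar_closure_bounded:
  assumes K: "p_Vstar_set p (james_space p) K"
  obtains R where "\<And>x. x \<in> closure K \<Longrightarrow> x \<in> vectors (james_space p) \<and> nrm (james_space p) x \<le> R"
proof -
  have KJ: "K \<subseteq> vectors (james_space p)" using K by (simp add: p_Vstar_set_def)
  obtain B0 where B0: "\<And>y. y \<in> K \<Longrightarrow> nrm (james_space p) y \<le> B0"
    using K by (auto simp: p_Vstar_set_def)
  define B where "B = max B0 0"
  have B: "0 \<le> B" "\<And>y. y \<in> K \<Longrightarrow> nrm (james_space p) y \<le> B"
    using B0 by (auto simp: B_def le_max_iff_disj)
  have "x \<in> vectors (james_space p) \<and> nrm (james_space p) x \<le> james_const * B"
    if x: "x \<in> closure K" for x
  proof -
    have le: "weighted_sum p x xs \<le> 2 * (james_const * B) powr p" if xs: "sorted_wrt (<) xs" for xs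
    proof (rule closure_weighted_sum_le[OF _ x])
      fix y assume y: "y \<in> K"
      then have yJ: "y \<in> vectors (james_space p)" using KJ by auto
      have "(james_const * nrm (james_space p) y) powr p \<le> (james_const * B) powr p"
        using james_norm_nonneg[OF yJ] james_const(1) B(2)[OF y] p
        by (intro powr_mono2 mult_left_mono) auto
      then show "weighted_sum p y xs \<le> 2 * (james_const * B) powr p"
        using weighted_sum_le_james_norm[OF yJ xs] by linarith
    qed
    show ?thesis
      using james_spaceI_weighted_sum[OF p_Vstar_closure_null[OF K x] _ le] B(1) james_const(1) by simp
  qed
  then show thesis by (rule that)
qed

lemma james_coordinate_weakly_continuous:
  "continuous_map (weak_topology (james_space p)) euclidean (\<lambda>x. x k)"
proof -
  define f where "f = (\<lambda>x. if x \<in> vectors (james_space p) then x k else 0 :: real)"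
  have "f \<in> vectors (dual (james_space p))"
    using james_norm_coordinate james_add(1) james_scale_le(1)
    by (intro dualI[where B = 1]) (auto simp: f_def scaleR_fun_def)
  then have "continuous_map (weak_topology (james_space p)) euclidean f"
    by (rule weak_topology_continuous_functional)
  then show ?thesis
    by (rule continuous_map_eq) (simp add: f_def topspace_weak_topology)
qed

lemma p_Vstar_relatively_weakly_compact:
  assumes K: "p_Vstar_set p (james_space p) K"
  shows "relatively_weakly_compact (james_space p) K"
proof -
  obtain R where R: "\<And>x. x \<in> closure K \<Longrightarrow> x \<in> vectors (james_space p) \<and> nrm (james_space p) x \<le> R"
    using p_Vstar_closure_bounded[OF K] by blast
  have "closure K \<subseteq> {x. \<forall>k. \<bar>x k\<bar> \<le> R}"
    using R james_norm_coordinate order_trans by blast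
  then have "compact (closure K)"
    using compact_Int_closed[OF compact_coordinate_box closed_closure, of R K]
    by (simp only: inf.absorb2)
  then show ?thesis
  proof (rule relatively_weakly_compactI[OF _ closed_closure closure_subset])
    show "closure K \<subseteq> vectors (james_space p)" using R by blast
    show "continuous_on (closure K) f" if "f \<in> vectors (dual (james_space p))" for f
      using james_dual_pointwise_continuous[OF that, of "closure K" R] R by blast
  qed (rule james_coordinate_weakly_continuous)
qed

end

theorem theorem2p11:
  fixes p :: real
  assumes "1 < p"
  shows "has_property_p_Vstar p (james_space p)"
proof -
  interpret james_exponent p using assms by unfold_locales
  show ?thesis
    unfolding has_property_p_Vstar_def
    using james_banach_space p_Vstar_relatively_weakly_compact by blast
qed

end
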